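(* Let $\kappa_1,\kappa_2,\kappa_3,\kappa_4$ be arbitrary parameters, let $K$ be an algebraic closure of $\mathbb{C}(\kappa_1,\dots,\kappa_4)$, and consider the non-abelian system (with $z$ a central parameter) $$\frac{du}{dt}=P_1(u,v)+\kappa_4zu,\qquad \frac{dv}{dt}=P_2(u,v)-\kappa_4zv\qquad(\ast)$$ where, with coefficients $a_i,b_i,c_i,d_i,e_1,f_1\in K$, $$P_1=a_1u^3v+a_2u^2vu+a_3uvu^2+(2-a_1-a_2-a_3)vu^3+c_1u^2v+(-4-c_1-c_2)uvu+c_2vu^2-\kappa_1u^2+e_1uv+(2-e_1)vu+(\kappa_1+\kappa_2)u-\kappa_2,$$ $$\begin{aligned}P_2=\;&b_1u^2v^2+b_2uvuv+b_3uv^2u+b_4vu^2v+b_5vuvu+\Big(-3-\sum_{i=1}^5b_i\Big)v^2u^2+d_1uv^2+(4-d_1-d_2)vuv+d_2v^2u\\&-v^2+f_1uv+(2\kappa_1-f_1)vu-(\kappa_1+\kappa_2)v+\kappa_3.\end{aligned}$$ Then $(\ast)$ has a non-abelian first integral of the form $$\begin{aligned}J=\;&p_1u^3v^2+p_2u^2vuv+p_3u^2v^2u+p_4uvu^2v+p_5uvuvu+p_6uv^2u^2+p_7vu^3v+p_8vu^2vu+p_9vuvu^2+\Big(1-\sum_{i=1}^9p_i\Big)v^2u^3\\&+q_1u^2v^2+q_2uvuv+q_3uv^2u+q_4vu^2v+q_5vuvu+\Big(-2-\sum_{i=1}^5q_i\Big)v^2u^2+r_1u^2v+r_2uvu+(-\kappa_1-r_1-r_2)vu^2\\&+s_1uv^2+s_2vuv+(1-s_1-s_2)v^2u+t_1uv+(\kappa_1+\kappa_2-t_1)vu-\kappa_3u-\kappa_2v+\kappa_3+z\big(w_1uv+(\kappa_4-w_1)vu\big)\end{aligned}$$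 (for some coefficients $p_i,q_i,r_i,s_i,t_1,w_1\in K$) if and only if $(\ast)$ is one of the following ten systems, where $$P_1=p-\kappa_1u^2+(\kappa_1+\kappa_2)u-\kappa_2,\qquad P_2=r-v^2-(\kappa_1+\kappa_2)v+\kappa_3,$$ $\theta$ denotes either element of $K$ with $\theta^2=\kappa_1^2+4\kappa_3$ (so $\kappa_3=\tfrac14(\theta^2-\kappa_1^2)$), and: (1) $p=2uvu^2-2uvu-2vu^2+2vu$, $r=-vu^2v-2vuvu+2vuv+2v^2u+\tfrac12(\kappa_1+\theta)uv+\tfrac12(3\kappa_1-\theta)vu$; (2) $p=2uvu^2-3uvu-vu^2+uv+vu$, $r=-vu^2v-2vuvu+3vuv+v^2u+\tfrac12(\kappa_1+\theta)uv+\tfrac12(3\kappa_1-\theta)vu$; (3) $p=uvu^2+vu^3-2uvu-2vu^2+uv+vu$, $r=-2vuvu-v^2u^2+2vuv+2v^2u+2\kappa_1vu$; (4) $p=uvu^2+vu^3-uvu-3vu^2+2vu$, $r=-2vuvu-v^2u^2+vuv+3v^2u+2\kappa_1vu$; (5) $p=u^2vu+uvu^2-u^2v-3uvu+2uv$, $r=-uvuv-vu^2v-vuvu+uv^2+3vuv+\kappa_1uv+\kappa_1vu$; (6) $p=u^2vu+uvu^2-3uvu-vu^2+2vu$, $r=-uvuv-vu^2v-vuvu+3vuv+v^2u+\kappa_1uv+\kappa_1vu$; (7) $p=2u^2vu-2u^2v-2uvu+2uv$, $r=-2uvuv-vu^2v+2uv^2+2vuv+\tfrac12(3\kappa_1-\theta)uv+\tfrac12(\kappa_1+\theta)vu$;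 (8) $p=2u^2vu-u^2v-3uvu+uv+vu$, $r=-2uvuv-vu^2v+uv^2+3vuv+\tfrac12(3\kappa_1-\theta)uv+\tfrac12(\kappa_1+\theta)vu$; (9) $p=u^3v+u^2vu-2u^2v-2uvu+uv+vu$, $r=-u^2v^2-2uvuv+2uv^2+2vuv+2\kappa_1uv$; (10) $p=u^3v+u^2vu-3u^2v-uvu+2uv$, $r=-u^2v^2-2uvuv+3uv^2+vuv+2\kappa_1uv$.
   Context: "Arbitrary parameters" means that $\kappa_1,\dots,\kappa_4$ are algebraically independent indeterminates over $\mathbb{C}$. The variables $u,v$ are generators of the free unital associative algebra $\mathcal{A}=K[z]\langle u,v\rangle$; $z$ is a central indeterminate (a parameter), and the coefficients of the system and of the integral do not depend on $z$. A system $du/dt=F_1,\ dv/dt=F_2$ with $F_1,F_2\in\mathcal{A}$ denotes the $K[z]$-linear derivation $d_t$ of $\mathcal{A}$ with $d_t(u)=F_1$, $d_t(v)=F_2$. An element $J\in\mathcal{A}$ is a non-abelian first integral if $d_t(J)=0$ in $\mathcal{A}$. (The system $(\ast)$ is the auxiliary autonomous system of the non-abelian Painlevé-5 system $zu'=P_1+\kappa_4zu$, $zv'=P_2-\kappa_4zv$.) *)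

theory Defs
  imports Complex_Main "HOL-Library.Poly_Mapping" "HOL-Computational_Algebra.Polynomial"
begin

section \<open>The base field: an algebraic closure of a field of rational functions\<close>

definition field_embedding :: "('a::field \<Rightarrow> 'k::field) \<Rightarrow> bool" where
  "field_embedding \<iota> \<longleftrightarrow>
     \<iota> 1 = 1 \<and> (\<forall>x y. \<iota> (x + y) = \<iota> x + \<iota> y) \<and> (\<forall>x y. \<iota> (x * y) = \<iota> x * \<iota> y)"

text \<open>A polynomial in four commuting indeterminates is represented by its finitely supported
  coefficient family, indexed by exponent tuples.\<close>

definition alg_independent4 :: "('a::field \<Rightarrow> 'k::field) \<Rightarrow> 'k \<Rightarrow> 'k \<Rightarrow> 'k \<Rightarrow> 'k \<Rightarrow> bool" where
  "alg_independent4 \<iota> x\<^sub>1 x\<^sub>2 x\<^sub>3 x\<^sub>4 \<longleftrightarrow>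
     (\<forall>f :: (nat \<times> nat \<times> nat \<times> nat) \<Rightarrow>\<^sub>0 'a.
        (\<Sum>(i, j, k, l)\<in>Poly_Mapping.keys f.
           \<iota> (Poly_Mapping.lookup f (i, j, k, l)) * x\<^sub>1 ^ i * x\<^sub>2 ^ j * x\<^sub>3 ^ k * x\<^sub>4 ^ l) = 0
        \<longrightarrow> f = 0)"

definition is_subfield :: "'k::field set \<Rightarrow> bool" where
  "is_subfield F \<longleftrightarrow> 0 \<in> F \<and> 1 \<in> F \<and>
     (\<forall>x\<in>F. \<forall>y\<in>F. x + y \<in> F \<and> x * y \<in> F) \<and> (\<forall>x\<in>F. - x \<in> F \<and> inverse x \<in> F)"

definition algebraic_over :: "'k::field set \<Rightarrow> 'k \<Rightarrow> bool" where
  "algebraic_over F x \<longleftrightarrow> (\<exists>p. p \<noteq> 0 \<and> (\<forall>i. coeff p i \<in> F) \<and> poly p x = 0)"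

text \<open>The type \<open>'k\<close>, an algebraically closed field by its sort, is an algebraic closure of
  \<open>\<complex>(\<kappa>\<^sub>1, \<kappa>\<^sub>2, \<kappa>\<^sub>3, \<kappa>\<^sub>4)\<close> with indeterminates \<open>\<kappa>\<^sub>i\<close>; complex numbers are embedded
  by \<open>\<iota>\<close>.\<close>

definition arbitrary_parameters ::
    "(complex \<Rightarrow> 'k::alg_closed_field) \<Rightarrow> 'k \<Rightarrow> 'k \<Rightarrow> 'k \<Rightarrow> 'k \<Rightarrow> bool" where
  "arbitrary_parameters \<iota> \<kappa>\<^sub>1 \<kappa>\<^sub>2 \<kappa>\<^sub>3 \<kappa>\<^sub>4 \<longleftrightarrow>
     field_embedding \<iota> \<and>
     alg_independent4 \<iota> \<kappa>\<^sub>1 \<kappa>\<^sub>2 \<kappa>\<^sub>3 \<kappa>\<^sub>4 \<and>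
     (\<forall>x. algebraic_over (is_subfield hull (range \<iota> \<union> {\<kappa>\<^sub>1, \<kappa>\<^sub>2, \<kappa>\<^sub>3, \<kappa>\<^sub>4})) x)"


section \<open>The free associative algebra \<open>K[z]\<langle>u, v\<rangle>\<close>\<close>

datatype gen = Gen_u | Gen_v

datatype word = Word (letters: "gen list")

instantiation word :: monoid_add
begin

definition zero_word :: word where
  "0 = Word []"

definition plus_word :: "word \<Rightarrow> word \<Rightarrow> word" where
  "x + y = Word (letters x @ letters y)"

instance
  by standard (auto simp: zero_word_def plus_word_def)

end

text \<open>The library's convolution product on finitely supported functions over the (additively
  written) monoid of words makes the following type the free unital associative algebra; it is an
  instance of \<^class>\<open>ring_1\<close>. The inner polynomials are the elements of \<open>K[z]\<close>.\<close>

type_synonym 'k free_alg = "word \<Rightarrow>\<^sub>0 'k poly"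

definition \<uu> :: "'k::field free_alg" where
  "\<uu> = Poly_Mapping.single (Word [Gen_u]) 1"

definition \<vv> :: "'k::field free_alg" where
  "\<vv> = Poly_Mapping.single (Word [Gen_v]) 1"

definition of_coeff :: "'k::field poly \<Rightarrow> 'k free_alg" where
  "of_coeff c = Poly_Mapping.single 0 c"

definition \<zz> :: "'k::field free_alg" where
  "\<zz> = of_coeff [:0, 1:]"

definition scale_alg :: "'k::field \<Rightarrow> 'k free_alg \<Rightarrow> 'k free_alg"  (infixr "\<cdot>" 69) where
  "c \<cdot> x = of_coeff [:c:] * x"


section \<open>Non-abelian systems and first integrals\<close>

definition kz_derivation :: "('k::field free_alg \<Rightarrow> 'k free_alg) \<Rightarrow> bool" where
  "kz_derivation D \<longleftrightarrow>
     (\<forall>x y. D (x + y) = D x + D y) \<and>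
     (\<forall>c x. D (of_coeff c * x) = of_coeff c * D x) \<and>
     (\<forall>x y. D (x * y) = D x * y + x * D y)"

definition time_derivative :: "'k::field free_alg \<Rightarrow> 'k free_alg \<Rightarrow> 'k free_alg \<Rightarrow> 'k free_alg" where
  "time_derivative F\<^sub>1 F\<^sub>2 = (THE D. kz_derivation D \<and> D \<uu> = F\<^sub>1 \<and> D \<vv> = F\<^sub>2)"

definition first_integral :: "'k::field free_alg \<Rightarrow> 'k free_alg \<Rightarrow> 'k free_alg \<Rightarrow> bool" where
  "first_integral F\<^sub>1 F\<^sub>2 J \<longleftrightarrow> time_derivative F\<^sub>1 F\<^sub>2 J = 0"

text \<open>The description in \<^const>\<open>time_derivative\<close> is proper: such a derivation exists and it is
  unique.\<close>

fun gen_deriv :: "'k::field free_alg \<Rightarrow> 'k free_alg \<Rightarrow> gen \<Rightarrow> 'k free_alg" where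
  "gen_deriv F\<^sub>1 F\<^sub>2 Gen_u = F\<^sub>1"
| "gen_deriv F\<^sub>1 F\<^sub>2 Gen_v = F\<^sub>2"

abbreviation word_mono :: "gen list \<Rightarrow> 'k::field free_alg" where
  "word_mono w \<equiv> Poly_Mapping.single (Word w) 1"

fun word_deriv :: "'k::field free_alg \<Rightarrow> 'k free_alg \<Rightarrow> gen list \<Rightarrow> 'k free_alg" where
  "word_deriv F\<^sub>1 F\<^sub>2 [] = 0"
| "word_deriv F\<^sub>1 F\<^sub>2 (g # w) =
     gen_deriv F\<^sub>1 F\<^sub>2 g * word_mono w + word_mono [g] * word_deriv F\<^sub>1 F\<^sub>2 w"

definition alg_deriv :: "'k::field free_alg \<Rightarrow> 'k free_alg \<Rightarrow> 'k free_alg \<Rightarrow> 'k free_alg" where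
  "alg_deriv F\<^sub>1 F\<^sub>2 x =
     (\<Sum>w\<in>Poly_Mapping.keys x. of_coeff (Poly_Mapping.lookup x w) * word_deriv F\<^sub>1 F\<^sub>2 (letters w))"

lemma word_mono_append: "word_mono (v @ w) = word_mono v * word_mono w"
  by (simp add: mult_single plus_word_def)

lemma word_mono_Nil: "word_mono [] = 1"
  by (metis single_one zero_word_def)

lemma single_conv_of_coeff: "Poly_Mapping.single w c = of_coeff c * word_mono (letters w)"
  by (simp add: of_coeff_def mult_single)

lemma free_alg_induct [case_names zero add]:
  assumes "P 0" and "\<And>c w x. P x \<Longrightarrow> P (of_coeff c * word_mono w + x)"
  shows "P (x :: 'k::field free_alg)"
proof (induction x rule: update_induct)
  case const
  then show ?case using assms(1) by simp
next
  case (update f a b)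
  have "Poly_Mapping.update a b f = Poly_Mapping.single a b + f"
    using update(1)
    by (intro poly_mapping_eqI)
      (auto simp: lookup_update lookup_add lookup_single in_keys_iff when_def)
  then show ?case using assms(2)[OF update(3), of b "letters a"]
    by (simp only: single_conv_of_coeff[symmetric])
qed

lemma of_coeff_add: "of_coeff (a + b) = of_coeff a + of_coeff b"
  by (simp add: of_coeff_def single_add)

lemma of_coeff_mult: "of_coeff (a * b) = of_coeff a * of_coeff b"
  by (simp add: of_coeff_def mult_single)

lemma of_coeff_0: "of_coeff 0 = 0"
  by (simp add: of_coeff_def)

lemma of_coeff_commute: "of_coeff c * x = x * of_coeff c"
proof (induction x rule: free_alg_induct)
  case zero
  then show ?case by simp
next
  case (add b w x)
  have "of_coeff c * (of_coeff b * word_mono w) = of_coeff b * word_mono w * of_coeff c"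
    by (simp add: of_coeff_def mult_single mult.commute)
  then show ?case using add by (simp add: distrib_left distrib_right)
qed

lemma alg_deriv_superset:
  assumes "finite S" "Poly_Mapping.keys x \<subseteq> S"
  shows "alg_deriv F\<^sub>1 F\<^sub>2 x =
    (\<Sum>w\<in>S. of_coeff (Poly_Mapping.lookup x w) * word_deriv F\<^sub>1 F\<^sub>2 (letters w))"
  unfolding alg_deriv_def using assms
  by (intro sum.mono_neutral_left) (auto simp: in_keys_iff of_coeff_0)

lemma alg_deriv_add: "alg_deriv F\<^sub>1 F\<^sub>2 (x + y) = alg_deriv F\<^sub>1 F\<^sub>2 x + alg_deriv F\<^sub>1 F\<^sub>2 y"
proof -
  let ?S = "Poly_Mapping.keys x \<union> Poly_Mapping.keys y"
  have "Poly_Mapping.keys (x + y) \<subseteq> ?S"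
    by (rule keys_add)
  then show ?thesis
    by (simp add: alg_deriv_superset[where S = ?S] lookup_add of_coeff_add distrib_right
        sum.distrib)
qed

lemma alg_deriv_0: "alg_deriv F\<^sub>1 F\<^sub>2 0 = 0"
  by (simp add: alg_deriv_def)

lemma alg_deriv_mono:
  "alg_deriv F\<^sub>1 F\<^sub>2 (of_coeff c * word_mono w) = of_coeff c * word_deriv F\<^sub>1 F\<^sub>2 w"
proof -
  have "of_coeff c * word_mono w = Poly_Mapping.single (Word w) c"
    by (simp add: of_coeff_def mult_single)
  then show ?thesis
    by (subst alg_deriv_superset[where S = "{Word w}"]) auto
qed

lemma alg_deriv_scale: "alg_deriv F\<^sub>1 F\<^sub>2 (of_coeff c * x) = of_coeff c * alg_deriv F\<^sub>1 F\<^sub>2 x"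
proof (induction x rule: free_alg_induct)
  case zero
  then show ?case by (simp add: alg_deriv_0)
next
  case (add b w x)
  have "alg_deriv F\<^sub>1 F\<^sub>2 (of_coeff c * (of_coeff b * word_mono w)) =
      of_coeff c * (of_coeff b * word_deriv F\<^sub>1 F\<^sub>2 w)"
    using alg_deriv_mono[of F\<^sub>1 F\<^sub>2 "c * b" w] by (simp add: of_coeff_mult mult.assoc)
  then show ?case using add by (simp add: distrib_left alg_deriv_add alg_deriv_mono)
qed

lemma word_deriv_append:
  "word_deriv F\<^sub>1 F\<^sub>2 (v @ w) = word_deriv F\<^sub>1 F\<^sub>2 v * word_mono w + word_mono v * word_deriv F\<^sub>1 F\<^sub>2 w"
proof (induction v)
  case Nil
  then show ?case by (simp add: word_mono_Nil)
next
  case (Cons g v)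
  have "word_mono (g # v) = word_mono [g] * word_mono v"
    using word_mono_append[of "[g]" v] by simp
  then have *: "word_mono [g] * word_mono v * word_deriv F\<^sub>1 F\<^sub>2 w =
      word_mono (g # v) * word_deriv F\<^sub>1 F\<^sub>2 w"
    by (rule arg_cong[OF sym])
  show ?case
    unfolding append_Cons word_deriv.simps Cons word_mono_append distrib_left distrib_right
    unfolding *[symmetric] by (simp only: mult.assoc add.assoc)
qed

lemma alg_deriv_word_mult:
  "alg_deriv F\<^sub>1 F\<^sub>2 (word_mono w * y) =
     word_deriv F\<^sub>1 F\<^sub>2 w * y + word_mono w * alg_deriv F\<^sub>1 F\<^sub>2 y"
proof (induction y rule: free_alg_induct)
  case zero
  then show ?case by (simp add: alg_deriv_0)
next
  case (add c v y)
  have pull: "of_coeff c * (x * y) = x * (of_coeff c * y)" for x y :: "'a free_alg"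
    by (metis of_coeff_commute mult.assoc)
  have "alg_deriv F\<^sub>1 F\<^sub>2 (word_mono w * (of_coeff c * word_mono v)) =
      alg_deriv F\<^sub>1 F\<^sub>2 (of_coeff c * word_mono (w @ v))"
    by (subst word_mono_append) (subst pull, rule refl)
  also have "\<dots> = of_coeff c * word_deriv F\<^sub>1 F\<^sub>2 (w @ v)"
    by (rule alg_deriv_mono)
  also have "\<dots> = word_deriv F\<^sub>1 F\<^sub>2 w * (of_coeff c * word_mono v) +
      word_mono w * (of_coeff c * word_deriv F\<^sub>1 F\<^sub>2 v)"
    unfolding word_deriv_append distrib_left
    using pull[of "word_deriv F\<^sub>1 F\<^sub>2 w" "word_mono v"]
      pull[of "word_mono w" "word_deriv F\<^sub>1 F\<^sub>2 v"] by (rule arg_cong2)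
  finally show ?case
    unfolding distrib_left alg_deriv_add alg_deriv_mono add by (simp only: add_ac)
qed

lemma alg_deriv_mult:
  "alg_deriv F\<^sub>1 F\<^sub>2 (x * y) = alg_deriv F\<^sub>1 F\<^sub>2 x * y + x * alg_deriv F\<^sub>1 F\<^sub>2 y"
proof (induction x rule: free_alg_induct)
  case zero
  then show ?case by (simp add: alg_deriv_0)
next
  case (add c w x)
  have "alg_deriv F\<^sub>1 F\<^sub>2 (of_coeff c * word_mono w * y) =
      of_coeff c * (word_deriv F\<^sub>1 F\<^sub>2 w * y + word_mono w * alg_deriv F\<^sub>1 F\<^sub>2 y)"
    by (simp only: mult.assoc alg_deriv_scale alg_deriv_word_mult)
  then show ?case
    unfolding distrib_right alg_deriv_add add alg_deriv_mono
    by (simp only: distrib_left mult.assoc add_ac)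
qed

lemma alg_deriv_derivation: "kz_derivation (alg_deriv F\<^sub>1 F\<^sub>2)"
  unfolding kz_derivation_def
  by (intro conjI allI; rule alg_deriv_add alg_deriv_scale alg_deriv_mult)

lemma of_coeff_1: "of_coeff 1 = 1"
  by (simp add: of_coeff_def)

lemma alg_deriv_gens: "alg_deriv F\<^sub>1 F\<^sub>2 \<uu> = F\<^sub>1" "alg_deriv F\<^sub>1 F\<^sub>2 \<vv> = F\<^sub>2"
  using alg_deriv_mono[of F\<^sub>1 F\<^sub>2 1 "[Gen_u]"] alg_deriv_mono[of F\<^sub>1 F\<^sub>2 1 "[Gen_v]"]
  by (simp_all add: \<uu>_def \<vv>_def of_coeff_1 word_mono_Nil)

lemma kz_derivation_unique:
  assumes D: "kz_derivation D" "D \<uu> = F\<^sub>1" "D \<vv> = F\<^sub>2"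
  shows "D = alg_deriv F\<^sub>1 F\<^sub>2"
proof
  have add: "D (x + y) = D x + D y" and mult: "D (x * y) = D x * y + x * D y"
    and scale: "D (of_coeff c * x) = of_coeff c * D x" for x y c
    using D(1) by (auto simp: kz_derivation_def)
  have zero: "D 0 = 0"
    using add[of 0 0] by simp
  have one: "D 1 = 0"
    using mult[of 1 1] by simp
  have gen: "D (word_mono [g]) = gen_deriv F\<^sub>1 F\<^sub>2 g" for g
    using D(2,3) by (cases g) (auto simp: \<uu>_def \<vv>_def)
  have word: "D (word_mono w) = word_deriv F\<^sub>1 F\<^sub>2 w" for w
  proof (induction w)
    case Nil
    then show ?case by (simp add: word_mono_Nil one)
  next
    case (Cons g w)
    have "word_mono (g # w) = word_mono [g] * word_mono w"
      using word_mono_append[of "[g]" w] by simp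
    then have "D (word_mono (g # w)) = D (word_mono [g] * word_mono w)"
      by (rule arg_cong)
    then show ?case
      unfolding mult gen Cons word_deriv.simps .
  qed
  fix x
  show "D x = alg_deriv F\<^sub>1 F\<^sub>2 x"
    by (induction x rule: free_alg_induct)
      (simp_all only: zero alg_deriv_0 add scale word alg_deriv_add alg_deriv_mono)
qed

lemma time_derivative_eq: "time_derivative F\<^sub>1 F\<^sub>2 = alg_deriv F\<^sub>1 F\<^sub>2"
  unfolding time_derivative_def
  by (rule the_equality) (auto simp: alg_deriv_derivation alg_deriv_gens kz_derivation_unique)

lemma time_derivative_derivation:
  "kz_derivation (time_derivative F\<^sub>1 F\<^sub>2)"
  "time_derivative F\<^sub>1 F\<^sub>2 \<uu> = F\<^sub>1" "time_derivative F\<^sub>1 F\<^sub>2 \<vv> = F\<^sub>2"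
  by (simp_all add: time_derivative_eq alg_deriv_derivation alg_deriv_gens)


section \<open>The system, the ansatz for the integral, and the ten systems\<close>

text \<open>Coefficient families \<open>a\<^sub>1, a\<^sub>2, \<dots>\<close> are functions on \<^typ>\<open>nat\<close>, of which only the values
  written below matter.\<close>

definition P1_poly :: "'k::field \<Rightarrow> 'k \<Rightarrow> (nat \<Rightarrow> 'k) \<Rightarrow> (nat \<Rightarrow> 'k) \<Rightarrow> 'k \<Rightarrow> 'k free_alg" where
  "P1_poly \<kappa>\<^sub>1 \<kappa>\<^sub>2 a c e\<^sub>1 =
       a 1 \<cdot> \<uu>^3*\<vv> + a 2 \<cdot> \<uu>^2*\<vv>*\<uu> + a 3 \<cdot> \<uu>*\<vv>*\<uu>^2 + (2 - a 1 - a 2 - a 3) \<cdot> \<vv>*\<uu>^3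
     + c 1 \<cdot> \<uu>^2*\<vv> + (- 4 - c 1 - c 2) \<cdot> \<uu>*\<vv>*\<uu> + c 2 \<cdot> \<vv>*\<uu>^2
     - \<kappa>\<^sub>1 \<cdot> \<uu>^2
     + e\<^sub>1 \<cdot> \<uu>*\<vv> + (2 - e\<^sub>1) \<cdot> \<vv>*\<uu>
     + (\<kappa>\<^sub>1 + \<kappa>\<^sub>2) \<cdot> \<uu> - \<kappa>\<^sub>2 \<cdot> 1"

definition P2_poly ::
    "'k::field \<Rightarrow> 'k \<Rightarrow> 'k \<Rightarrow> (nat \<Rightarrow> 'k) \<Rightarrow> (nat \<Rightarrow> 'k) \<Rightarrow> 'k \<Rightarrow> 'k free_alg" where
  "P2_poly \<kappa>\<^sub>1 \<kappa>\<^sub>2 \<kappa>\<^sub>3 b d f\<^sub>1 =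
       b 1 \<cdot> \<uu>^2*\<vv>^2 + b 2 \<cdot> \<uu>*\<vv>*\<uu>*\<vv> + b 3 \<cdot> \<uu>*\<vv>^2*\<uu> + b 4 \<cdot> \<vv>*\<uu>^2*\<vv>
     + b 5 \<cdot> \<vv>*\<uu>*\<vv>*\<uu> + (- 3 - (\<Sum>i=1..5. b i)) \<cdot> \<vv>^2*\<uu>^2
     + d 1 \<cdot> \<uu>*\<vv>^2 + (4 - d 1 - d 2) \<cdot> \<vv>*\<uu>*\<vv> + d 2 \<cdot> \<vv>^2*\<uu>
     - \<vv>^2
     + f\<^sub>1 \<cdot> \<uu>*\<vv> + (2 * \<kappa>\<^sub>1 - f\<^sub>1) \<cdot> \<vv>*\<uu>
     - (\<kappa>\<^sub>1 + \<kappa>\<^sub>2) \<cdot> \<vv> + \<kappa>\<^sub>3 \<cdot> 1"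

definition J_poly ::
    "'k::field \<Rightarrow> 'k \<Rightarrow> 'k \<Rightarrow> 'k \<Rightarrow> (nat \<Rightarrow> 'k) \<Rightarrow> (nat \<Rightarrow> 'k) \<Rightarrow> (nat \<Rightarrow> 'k) \<Rightarrow> (nat \<Rightarrow> 'k) \<Rightarrow>
     'k \<Rightarrow> 'k \<Rightarrow> 'k free_alg" where
  "J_poly \<kappa>\<^sub>1 \<kappa>\<^sub>2 \<kappa>\<^sub>3 \<kappa>\<^sub>4 p q r s t\<^sub>1 w\<^sub>1 =
       p 1 \<cdot> \<uu>^3*\<vv>^2 + p 2 \<cdot> \<uu>^2*\<vv>*\<uu>*\<vv> + p 3 \<cdot> \<uu>^2*\<vv>^2*\<uu> + p 4 \<cdot> \<uu>*\<vv>*\<uu>^2*\<vv>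
     + p 5 \<cdot> \<uu>*\<vv>*\<uu>*\<vv>*\<uu> + p 6 \<cdot> \<uu>*\<vv>^2*\<uu>^2 + p 7 \<cdot> \<vv>*\<uu>^3*\<vv> + p 8 \<cdot> \<vv>*\<uu>^2*\<vv>*\<uu>
     + p 9 \<cdot> \<vv>*\<uu>*\<vv>*\<uu>^2 + (1 - (\<Sum>i=1..9. p i)) \<cdot> \<vv>^2*\<uu>^3
     + q 1 \<cdot> \<uu>^2*\<vv>^2 + q 2 \<cdot> \<uu>*\<vv>*\<uu>*\<vv> + q 3 \<cdot> \<uu>*\<vv>^2*\<uu> + q 4 \<cdot> \<vv>*\<uu>^2*\<vv>
     + q 5 \<cdot> \<vv>*\<uu>*\<vv>*\<uu> + (- 2 - (\<Sum>i=1..5. q i)) \<cdot> \<vv>^2*\<uu>^2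
     + r 1 \<cdot> \<uu>^2*\<vv> + r 2 \<cdot> \<uu>*\<vv>*\<uu> + (- \<kappa>\<^sub>1 - r 1 - r 2) \<cdot> \<vv>*\<uu>^2
     + s 1 \<cdot> \<uu>*\<vv>^2 + s 2 \<cdot> \<vv>*\<uu>*\<vv> + (1 - s 1 - s 2) \<cdot> \<vv>^2*\<uu>
     + t\<^sub>1 \<cdot> \<uu>*\<vv> + (\<kappa>\<^sub>1 + \<kappa>\<^sub>2 - t\<^sub>1) \<cdot> \<vv>*\<uu>
     - \<kappa>\<^sub>3 \<cdot> \<uu> - \<kappa>\<^sub>2 \<cdot> \<vv> + \<kappa>\<^sub>3 \<cdot> 1
     + \<zz> * (w\<^sub>1 \<cdot> \<uu>*\<vv> + (\<kappa>\<^sub>4 - w\<^sub>1) \<cdot> \<vv>*\<uu>)"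

text \<open>The right-hand sides of the system with given \<open>P\<^sub>1\<close>, \<open>P\<^sub>2\<close>.\<close>

definition p5_system ::
    "'k::field \<Rightarrow> 'k free_alg \<Rightarrow> 'k free_alg \<Rightarrow> 'k free_alg \<times> 'k free_alg" where
  "p5_system \<kappa>\<^sub>4 P\<^sub>1 P\<^sub>2 = (P\<^sub>1 + \<kappa>\<^sub>4 \<cdot> \<zz>*\<uu>, P\<^sub>2 - \<kappa>\<^sub>4 \<cdot> \<zz>*\<vv>)"

definition listed_parts :: "'k::field \<Rightarrow> 'k \<Rightarrow> ('k free_alg \<times> 'k free_alg) list" where
  "listed_parts \<kappa>\<^sub>1 \<theta> =
   [(2 \<cdot> \<uu>*\<vv>*\<uu>^2 - 2 \<cdot> \<uu>*\<vv>*\<uu> - 2 \<cdot> \<vv>*\<uu>^2 + 2 \<cdot> \<vv>*\<uu>,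
     - (\<vv>*\<uu>^2*\<vv>) - 2 \<cdot> \<vv>*\<uu>*\<vv>*\<uu> + 2 \<cdot> \<vv>*\<uu>*\<vv> + 2 \<cdot> \<vv>^2*\<uu>
       + ((\<kappa>\<^sub>1 + \<theta>) / 2) \<cdot> \<uu>*\<vv> + ((3 * \<kappa>\<^sub>1 - \<theta>) / 2) \<cdot> \<vv>*\<uu>),
    (2 \<cdot> \<uu>*\<vv>*\<uu>^2 - 3 \<cdot> \<uu>*\<vv>*\<uu> - \<vv>*\<uu>^2 + \<uu>*\<vv> + \<vv>*\<uu>,
     - (\<vv>*\<uu>^2*\<vv>) - 2 \<cdot> \<vv>*\<uu>*\<vv>*\<uu> + 3 \<cdot> \<vv>*\<uu>*\<vv> + \<vv>^2*\<uu>
       + ((\<kappa>\<^sub>1 + \<theta>) / 2) \<cdot> \<uu>*\<vv> + ((3 * \<kappa>\<^sub>1 - \<theta>) / 2) \<cdot> \<vv>*\<uu>),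
    (\<uu>*\<vv>*\<uu>^2 + \<vv>*\<uu>^3 - 2 \<cdot> \<uu>*\<vv>*\<uu> - 2 \<cdot> \<vv>*\<uu>^2 + \<uu>*\<vv> + \<vv>*\<uu>,
     - (2 \<cdot> \<vv>*\<uu>*\<vv>*\<uu>) - \<vv>^2*\<uu>^2 + 2 \<cdot> \<vv>*\<uu>*\<vv> + 2 \<cdot> \<vv>^2*\<uu> + (2 * \<kappa>\<^sub>1) \<cdot> \<vv>*\<uu>),
    (\<uu>*\<vv>*\<uu>^2 + \<vv>*\<uu>^3 - \<uu>*\<vv>*\<uu> - 3 \<cdot> \<vv>*\<uu>^2 + 2 \<cdot> \<vv>*\<uu>,
     - (2 \<cdot> \<vv>*\<uu>*\<vv>*\<uu>) - \<vv>^2*\<uu>^2 + \<vv>*\<uu>*\<vv> + 3 \<cdot> \<vv>^2*\<uu> + (2 * \<kappa>\<^sub>1) \<cdot> \<vv>*\<uu>),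
    (\<uu>^2*\<vv>*\<uu> + \<uu>*\<vv>*\<uu>^2 - \<uu>^2*\<vv> - 3 \<cdot> \<uu>*\<vv>*\<uu> + 2 \<cdot> \<uu>*\<vv>,
     - (\<uu>*\<vv>*\<uu>*\<vv>) - \<vv>*\<uu>^2*\<vv> - \<vv>*\<uu>*\<vv>*\<uu> + \<uu>*\<vv>^2 + 3 \<cdot> \<vv>*\<uu>*\<vv>
       + \<kappa>\<^sub>1 \<cdot> \<uu>*\<vv> + \<kappa>\<^sub>1 \<cdot> \<vv>*\<uu>),
    (\<uu>^2*\<vv>*\<uu> + \<uu>*\<vv>*\<uu>^2 - 3 \<cdot> \<uu>*\<vv>*\<uu> - \<vv>*\<uu>^2 + 2 \<cdot> \<vv>*\<uu>,
     - (\<uu>*\<vv>*\<uu>*\<vv>) - \<vv>*\<uu>^2*\<vv> - \<vv>*\<uu>*\<vv>*\<uu> + 3 \<cdot> \<vv>*\<uu>*\<vv> + \<vv>^2*\<uu>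
       + \<kappa>\<^sub>1 \<cdot> \<uu>*\<vv> + \<kappa>\<^sub>1 \<cdot> \<vv>*\<uu>),
    (2 \<cdot> \<uu>^2*\<vv>*\<uu> - 2 \<cdot> \<uu>^2*\<vv> - 2 \<cdot> \<uu>*\<vv>*\<uu> + 2 \<cdot> \<uu>*\<vv>,
     - (2 \<cdot> \<uu>*\<vv>*\<uu>*\<vv>) - \<vv>*\<uu>^2*\<vv> + 2 \<cdot> \<uu>*\<vv>^2 + 2 \<cdot> \<vv>*\<uu>*\<vv>
       + ((3 * \<kappa>\<^sub>1 - \<theta>) / 2) \<cdot> \<uu>*\<vv> + ((\<kappa>\<^sub>1 + \<theta>) / 2) \<cdot> \<vv>*\<uu>),
    (2 \<cdot> \<uu>^2*\<vv>*\<uu> - \<uu>^2*\<vv> - 3 \<cdot> \<uu>*\<vv>*\<uu> + \<uu>*\<vv> + \<vv>*\<uu>,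
     - (2 \<cdot> \<uu>*\<vv>*\<uu>*\<vv>) - \<vv>*\<uu>^2*\<vv> + \<uu>*\<vv>^2 + 3 \<cdot> \<vv>*\<uu>*\<vv>
       + ((3 * \<kappa>\<^sub>1 - \<theta>) / 2) \<cdot> \<uu>*\<vv> + ((\<kappa>\<^sub>1 + \<theta>) / 2) \<cdot> \<vv>*\<uu>),
    (\<uu>^3*\<vv> + \<uu>^2*\<vv>*\<uu> - 2 \<cdot> \<uu>^2*\<vv> - 2 \<cdot> \<uu>*\<vv>*\<uu> + \<uu>*\<vv> + \<vv>*\<uu>,
     - (\<uu>^2*\<vv>^2) - 2 \<cdot> \<uu>*\<vv>*\<uu>*\<vv> + 2 \<cdot> \<uu>*\<vv>^2 + 2 \<cdot> \<vv>*\<uu>*\<vv> + (2 * \<kappa>\<^sub>1) \<cdot> \<uu>*\<vv>),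
    (\<uu>^3*\<vv> + \<uu>^2*\<vv>*\<uu> - 3 \<cdot> \<uu>^2*\<vv> - \<uu>*\<vv>*\<uu> + 2 \<cdot> \<uu>*\<vv>,
     - (\<uu>^2*\<vv>^2) - 2 \<cdot> \<uu>*\<vv>*\<uu>*\<vv> + 3 \<cdot> \<uu>*\<vv>^2 + \<vv>*\<uu>*\<vv> + (2 * \<kappa>\<^sub>1) \<cdot> \<uu>*\<vv>)]"

text \<open>Both square roots \<open>\<theta>\<close> of \<open>\<kappa>\<^sub>1\<^sup>2 + 4 \<kappa>\<^sub>3\<close> are admitted.\<close>

definition listed_systems ::
    "'k::field \<Rightarrow> 'k \<Rightarrow> 'k \<Rightarrow> 'k \<Rightarrow> ('k free_alg \<times> 'k free_alg) set" where
  "listed_systems \<kappa>\<^sub>1 \<kappa>\<^sub>2 \<kappa>\<^sub>3 \<kappa>\<^sub>4 =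
     {p5_system \<kappa>\<^sub>4 (p - \<kappa>\<^sub>1 \<cdot> \<uu>^2 + (\<kappa>\<^sub>1 + \<kappa>\<^sub>2) \<cdot> \<uu> - \<kappa>\<^sub>2 \<cdot> 1)
                   (r - \<vv>^2 - (\<kappa>\<^sub>1 + \<kappa>\<^sub>2) \<cdot> \<vv> + \<kappa>\<^sub>3 \<cdot> 1)
       | p r \<theta>. \<theta>^2 = \<kappa>\<^sub>1^2 + 4 * \<kappa>\<^sub>3 \<and> (p, r) \<in> set (listed_parts \<kappa>\<^sub>1 \<theta>)}"

end

theory Submission
  imports Defs
begin

text \<open>The part of \<open>dJ/dt = 0\<close> linear in \<open>z\<close> expresses the unbalanced coefficients of \<open>J\<close> (those of words
  with different numbers of \<open>u\<close> and \<open>v\<close>) linearly through the system: up to \<open>\<kappa>\<^sub>4\<close> and the degree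
  difference, they are the coefficients of \<open>- d/dt (w\<^sub>1 u v + w\<^sub>2 v u)\<close> at \<open>z = 0\<close>, with
  \<open>w\<^sub>2 = \<kappa>\<^sub>4 - w\<^sub>1\<close>. Substituting this, the extreme words of length eight give equations such as
  \<open>w\<^sub>1 (a\<^sub>1 + b\<^sub>1)\<^sup>2 = 0\<close>. If \<open>w\<^sub>1\<close> and \<open>w\<^sub>2\<close> are both nonzero, only one leading part survives, and the words of
  length at most seven exclude it. Reversal of words is an anti-automorphism exchanging \<open>w\<^sub>1\<close> and \<open>w\<^sub>2\<close>, so let
  \<open>w\<^sub>1 = 0\<close>. Then the leading coefficients \<open>p\<^sub>5, p\<^sub>8, p\<^sub>9\<close> of \<open>J\<close> are orthogonal idempotents with sum \<open>1\<close>, which leaves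
  three leading parts; the shorter words determine the rest, up to the choice \<open>e\<^sub>1 \<in> {0, 1}\<close> and a root of
  \<open>f\<^sub>1\<^sup>2 = \<kappa>\<^sub>1 f\<^sub>1 + \<kappa>\<^sub>3\<close>, where \<open>\<theta> = 2 f\<^sub>1 - \<kappa>\<^sub>1\<close>.\<close>

section \<open>Elements of the free algebra as tries\<close>

text \<open>A node stands for \<open>c + u l + v r\<close>, so the coefficient of a word is found by walking down
  its letters; equality of such elements is decided by evaluation.\<close>

datatype 'c trie = Leaf | Node 'c "'c trie" "'c trie"

primrec alg_of :: "'k::field poly trie \<Rightarrow> 'k free_alg" where
  "alg_of Leaf = 0"
| "alg_of (Node c l r) = of_coeff c + \<uu> * alg_of l + \<vv> * alg_of r"

fun coeff_at :: "'c::zero trie \<Rightarrow> gen list \<Rightarrow> 'c" where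
  "coeff_at Leaf w = 0"
| "coeff_at (Node c l r) [] = c"
| "coeff_at (Node c l r) (Gen_u # w) = coeff_at l w"
| "coeff_at (Node c l r) (Gen_v # w) = coeff_at r w"

fun add_trie :: "'c::plus trie \<Rightarrow> 'c trie \<Rightarrow> 'c trie" where
  "add_trie Leaf t = t"
| "add_trie s Leaf = s"
| "add_trie (Node c l r) (Node d l' r') = Node (c + d) (add_trie l l') (add_trie r r')"

primrec scale_trie :: "'c::times \<Rightarrow> 'c trie \<Rightarrow> 'c trie" where
  "scale_trie a Leaf = Leaf"
| "scale_trie a (Node c l r) = Node (a * c) (scale_trie a l) (scale_trie a r)"

primrec mult_trie :: "'c::semiring_0 trie \<Rightarrow> 'c trie \<Rightarrow> 'c trie" where
  "mult_trie Leaf t = Leaf"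
| "mult_trie (Node c l r) t =
     add_trie (scale_trie c t) (Node 0 (mult_trie l t) (mult_trie r t))"

text \<open>Leibniz rule for \<open>c + u l + v r\<close>: \<open>f\<close> and \<open>g\<close> are
  the derivatives of \<open>u\<close> and \<open>v\<close>, and the coefficient \<open>c\<close> is
  a constant.\<close>

primrec deriv_trie :: "'c::semiring_0 trie \<Rightarrow> 'c trie \<Rightarrow> 'c trie \<Rightarrow> 'c trie" where
  "deriv_trie f g Leaf = Leaf"
| "deriv_trie f g (Node c l r) =
     add_trie (add_trie (mult_trie f l) (mult_trie g r))
       (Node 0 (deriv_trie f g l) (deriv_trie f g r))"

lemma coeff_at_add [simp]:
  "coeff_at (add_trie s t) w = coeff_at s w + coeff_at (t :: 'c::monoid_add trie) w"
proof (induction s t arbitrary: w rule: add_trie.induct)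
  case (3 c l r d l' r')
  then show ?case
    by (cases "(Node c l r, w)" rule: coeff_at.cases) auto
qed auto

lemma coeff_at_scale [simp]:
  "coeff_at (scale_trie a t) w = a * coeff_at (t :: 'c::mult_zero trie) w"
  by (induction t w rule: coeff_at.induct) auto

lemma alg_of_scale: "alg_of (scale_trie a t) = of_coeff a * alg_of t"
proof (induction t)
  case (Node c l r)
  have "g * (of_coeff a * x) = of_coeff a * (g * x)" for g x :: "'a free_alg"
    by (metis of_coeff_commute mult.assoc)
  with Node show ?case
    by (simp add: of_coeff_mult distrib_left mult.assoc)
qed simp

lemma alg_of_add: "alg_of (add_trie s t) = alg_of s + alg_of t"
  by (induction s t rule: add_trie.induct) (simp_all add: of_coeff_add distrib_left add_ac)

lemma alg_of_mult: "alg_of (mult_trie s t) = alg_of s * alg_of t"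
  by (induction s)
    (simp_all add: alg_of_add alg_of_scale of_coeff_0 distrib_right mult.assoc add.assoc)

lemma time_derivative_of_coeff: "time_derivative f g (of_coeff c) = 0"
  using alg_deriv_mono[of f g c "[]"] by (simp add: time_derivative_eq word_mono_Nil)

lemma time_derivative_alg_of:
  "time_derivative (alg_of f) (alg_of g) (alg_of t) = alg_of (deriv_trie f g t)"
proof (induction t)
  case Leaf
  then show ?case by (simp add: time_derivative_eq alg_deriv_0)
next
  case (Node c l r)
  let ?D = "time_derivative (alg_of f) (alg_of g)"
  have "?D (x + y) = ?D x + ?D y" "?D (x * y) = ?D x * y + x * ?D y" for x y
    using time_derivative_derivation(1)[of "alg_of f" "alg_of g"]
    by (simp_all add: kz_derivation_def)
  with Node show ?case
    by (simp add: alg_of_add alg_of_mult time_derivative_of_coeff time_derivative_derivation(2,3)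
        of_coeff_0 add_ac)
qed

text \<open>Left multiplication by a letter prepends it to every word, which is what one step down a
  trie undoes.\<close>

lemma lookup_letter_mult:
  "Poly_Mapping.lookup (word_mono [g] * x) (Word w) =
     (case w of [] \<Rightarrow> 0 | h # w' \<Rightarrow> if h = g then Poly_Mapping.lookup x (Word w') else 0)"
proof (induction x rule: free_alg_induct)
  case zero
  then show ?case by (simp split: list.split)
next
  case (add c v x)
  have "word_mono [g] * (of_coeff c * word_mono v) = Poly_Mapping.single (Word (g # v)) c"
    by (simp add: of_coeff_def mult_single plus_word_def zero_word_def)
  moreover have "of_coeff c * word_mono v = Poly_Mapping.single (Word v) c"
    by (simp add: of_coeff_def mult_single)
  ultimately show ?case
    using add by (auto simp: distrib_left lookup_add lookup_single when_def split: list.split)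
qed

lemma lookup_alg_of: "Poly_Mapping.lookup (alg_of t) (Word w) = coeff_at t w"
  by (induction t w rule: coeff_at.induct)
    (simp_all add: lookup_add \<uu>_def \<vv>_def lookup_letter_mult of_coeff_def lookup_single
      zero_word_def)

lemma alg_of_eq_0_iff: "alg_of t = 0 \<longleftrightarrow> (\<forall>w. coeff_at t w = 0)"
proof
  assume *: "\<forall>w. coeff_at t w = 0"
  have "Poly_Mapping.lookup (alg_of t) w = 0" for w
    using * by (cases w) (simp add: lookup_alg_of)
  then show "alg_of t = 0"
    by (intro poly_mapping_eqI) simp
qed (simp flip: lookup_alg_of)

text \<open>Turns the integral condition into one equation over \<open>K[z]\<close> for each word,
  which the simplifier can compute.\<close>

lemma first_integral_alg_of:
  "first_integral (alg_of f) (alg_of g) (alg_of j) \<longleftrightarrow> (\<forall>w. coeff_at (deriv_trie f g j) w = 0)"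
  by (simp add: first_integral_def time_derivative_alg_of alg_of_eq_0_iff)

section \<open>The general system and the general integral\<close>

text \<open>Every word gets its own parameter here, numbered in the order of the ansatz; the prescribed
  commutative images become linear relations between parameters (\<open>a_sum\<close> etc., below). This keeps
  all formulas symmetric under reversal of words.\<close>

definition field_u where
  "field_u
     \<kappa>\<^sub>1 \<kappa>\<^sub>2 \<kappa>\<^sub>4 a1 a2 a3 a4 c1 c2 c3 e1 e2 =
     Node [:- \<kappa>\<^sub>2:]
      (Node [:\<kappa>\<^sub>1 + \<kappa>\<^sub>2, \<kappa>\<^sub>4:]
        (Node [:- \<kappa>\<^sub>1:]
          (Node 0 Leaf (Node [:a1:] Leaf Leaf))
          (Node [:c1:] (Node [:a2:] Leaf Leaf) Leaf))
        (Node [:e1:] (Node [:c2:] (Node [:a3:] Leaf Leaf) Leaf) Leaf))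
      (Node 0
        (Node [:e2:] (Node [:c3:] (Node [:a4:] Leaf Leaf) Leaf) Leaf)
        Leaf)"

text \<open>The \<open>z\<close>-terms of the system are the second entries of the linear
  coefficients: \<open>\<kappa>\<^sub>4\<close> at \<open>u\<close> in \<open>field_u\<close>,
  \<open>- \<kappa>\<^sub>4\<close> at \<open>v\<close> here.\<close>

definition field_v where
  "field_v
     \<kappa>\<^sub>1 \<kappa>\<^sub>2 \<kappa>\<^sub>3 \<kappa>\<^sub>4 b1 b2 b3 b4 b5 b6 d1 d2 d3 f1 f2 =
     Node [:\<kappa>\<^sub>3:]
      (Node 0
        (Node 0 Leaf (Node 0 Leaf (Node [:b1:] Leaf Leaf)))
        (Node [:f1:]
          (Node 0 Leaf (Node [:b2:] Leaf Leaf))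
          (Node [:d1:] (Node [:b3:] Leaf Leaf) Leaf)))
      (Node [:- (\<kappa>\<^sub>1 + \<kappa>\<^sub>2), - \<kappa>\<^sub>4:]
        (Node [:f2:]
          (Node 0 Leaf (Node [:b4:] Leaf Leaf))
          (Node [:d2:] (Node [:b5:] Leaf Leaf) Leaf))
        (Node [:- 1:] (Node [:d3:] (Node [:b6:] Leaf Leaf) Leaf) Leaf))"

definition integral_ansatz where
  "integral_ansatz
     \<kappa>\<^sub>2 \<kappa>\<^sub>3 p1 p2 p3 p4 p5 p6 p7 p8 p9 p10 q1 q2 q3 q4 q5 q6 r1 r2 r3 s1 s2 s3 t1 t2 w1 w2 =
     Node [:\<kappa>\<^sub>3:]
      (Node [:- \<kappa>\<^sub>3:]
        (Node 0
          (Node 0 Leaf (Node 0 Leaf (Node [:p1:] Leaf Leaf)))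
          (Node [:r1:]
            (Node 0 Leaf (Node [:p2:] Leaf Leaf))
            (Node [:q1:] (Node [:p3:] Leaf Leaf) Leaf)))
        (Node [:t1, w1:]
          (Node [:r2:]
            (Node 0 Leaf (Node [:p4:] Leaf Leaf))
            (Node [:q2:] (Node [:p5:] Leaf Leaf) Leaf))
          (Node [:s1:] (Node [:q3:] (Node [:p6:] Leaf Leaf) Leaf) Leaf)))
      (Node [:- \<kappa>\<^sub>2:]
        (Node [:t2, w2:]
          (Node [:r3:]
            (Node 0 Leaf (Node [:p7:] Leaf Leaf))
            (Node [:q4:] (Node [:p8:] Leaf Leaf) Leaf))
          (Node [:s2:] (Node [:q5:] (Node [:p9:] Leaf Leaf) Leaf) Leaf))
        (Node 0
          (Node [:s3:] (Node [:q6:] (Node [:p10:] Leaf Leaf) Leaf) Leaf)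
          Leaf))"

text \<open>All coefficients are locale parameters, so that the reversed system with the reversed
  integral forms a second instance.\<close>

locale integral_coefficients =
  fixes \<kappa>\<^sub>1 \<kappa>\<^sub>2 \<kappa>\<^sub>3 \<kappa>\<^sub>4 :: "'k::field"
    and a1 a2 a3 a4 b1 b2 b3 b4 b5 b6 c1 c2 c3 d1 d2 d3 e1 e2 f1 f2 :: 'k
    and p1 p2 p3 p4 p5 p6 p7 p8 p9 p10 q1 q2 q3 q4 q5 q6 r1 r2 r3 s1 s2 s3 t1 t2 w1 w2 :: 'k
  assumes nonzero: "(2 :: 'k) \<noteq> 0" "(3 :: 'k) \<noteq> 0" "\<kappa>\<^sub>4 \<noteq> 0"
    and a_sum: "a1 + a2 + a3 + a4 = 2"
    and b_sum: "b1 + b2 + b3 + b4 + b5 + b6 = - 3"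
    and c_sum: "c1 + c2 + c3 = - 4"
    and e_sum: "e1 + e2 = 2"
    and f_sum: "f1 + f2 = 2 * \<kappa>\<^sub>1"
    and q_sum: "q1 + q2 + q3 + q4 + q5 + q6 = - 2"
    and r_sum: "r1 + r2 + r3 = - \<kappa>\<^sub>1"
    and s_sum: "s1 + s2 + s3 = 1"
    and w_sum: "w1 + w2 = \<kappa>\<^sub>4"
    and integral: "first_integral
      (alg_of (field_u \<kappa>\<^sub>1 \<kappa>\<^sub>2 \<kappa>\<^sub>4 a1 a2 a3 a4 c1 c2 c3 e1 e2))
      (alg_of (field_v \<kappa>\<^sub>1 \<kappa>\<^sub>2 \<kappa>\<^sub>3 \<kappa>\<^sub>4 b1 b2 b3 b4 b5 b6 d1 d2 d3 f1 f2))
      (alg_of (integral_ansatz \<kappa>\<^sub>2 \<kappa>\<^sub>3 p1 p2 p3 p4 p5 p6 p7 p8 p9 p10 q1 q2 q3 q4 q5 q6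
         r1 r2 r3 s1 s2 s3 t1 t2 w1 w2))"
begin

lemma vanish:
  "coeff_at (deriv_trie (field_u \<kappa>\<^sub>1 \<kappa>\<^sub>2 \<kappa>\<^sub>4 a1 a2 a3 a4 c1 c2 c3 e1 e2)
     (field_v \<kappa>\<^sub>1 \<kappa>\<^sub>2 \<kappa>\<^sub>3 \<kappa>\<^sub>4 b1 b2 b3 b4 b5 b6 d1 d2 d3 f1 f2)
     (integral_ansatz \<kappa>\<^sub>2 \<kappa>\<^sub>3 p1 p2 p3 p4 p5 p6 p7 p8 p9 p10 q1 q2 q3 q4 q5 q6
         r1 r2 r3 s1 s2 s3 t1 t2 w1 w2)) w = 0"
  using integral unfolding first_integral_alg_of by blast

text \<open>With the tries explicit, simplification at a concrete word yields a polynomial in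
  \<open>z\<close> equal to zero, hence one equation for each power of \<open>z\<close>.\<close>

lemmas vanish' = vanish[unfolded field_u_def field_v_def integral_ansatz_def]

section \<open>Words of length eight: quadratic equations between leading coefficients\<close>

text \<open>The lemma named by a word is the vanishing of the coefficient of that word in \<open>dJ/dt\<close> at
  \<open>z = 0\<close>; with the prefix \<open>z_\<close> it is the coefficient of \<open>z\<close> times the word.\<close>

lemma uuuuuvvv: "a1 * p1 + b1 * p1 = 0"
  using vanish'[of "[Gen_u, Gen_u, Gen_u, Gen_u, Gen_u, Gen_v, Gen_v, Gen_v]"] by (simp add: algebra_simps)

lemma vvvuuuuu: "a4 * p10 + b6 * p10 = 0"
  using vanish'[of "[Gen_v, Gen_v, Gen_v, Gen_u, Gen_u, Gen_u, Gen_u, Gen_u]"] by (simp add: algebra_simps)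

lemma uuuuvvvu: "a1 * p3 + b1 * p3 = 0"
  using vanish'[of "[Gen_u, Gen_u, Gen_u, Gen_u, Gen_v, Gen_v, Gen_v, Gen_u]"] by (simp add: algebra_simps)

lemma uuuvvuuv: "a1 * p4 + b1 * p4 + b3 * p2 + b4 * p1 + b6 * p1 = 0"
  using vanish'[of "[Gen_u, Gen_u, Gen_u, Gen_v, Gen_v, Gen_u, Gen_u, Gen_v]"] by (simp add: algebra_simps)

lemma uuuvvuvu: "a1 * p5 + b1 * p5 + b3 * p3 + b5 * p1 = 0"
  using vanish'[of "[Gen_u, Gen_u, Gen_u, Gen_v, Gen_v, Gen_u, Gen_v, Gen_u]"] by (simp add: algebra_simps)

lemma vuuvvuuu: "a4 * p8 + b1 * p10 + b3 * p9 + b4 * p10 + b6 * p8 = 0"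
  using vanish'[of "[Gen_v, Gen_u, Gen_u, Gen_v, Gen_v, Gen_u, Gen_u, Gen_u]"] by (simp add: algebra_simps)

lemma uvuvvuuu: "a4 * p5 + b2 * p10 + b3 * p6 + b6 * p5 = 0"
  using vanish'[of "[Gen_u, Gen_v, Gen_u, Gen_v, Gen_v, Gen_u, Gen_u, Gen_u]"] by (simp add: algebra_simps)

lemma uuvvuuuv: "a1 * p3 + a4 * p2 + b1 * p7 + b3 * p4 + b6 * p2 = 0"
  using vanish'[of "[Gen_u, Gen_u, Gen_v, Gen_v, Gen_u, Gen_u, Gen_u, Gen_v]"] by (simp add: algebra_simps)

lemma vuuuvvuu: "a1 * p9 + a4 * p6 + b1 * p9 + b3 * p8 + b6 * p7 = 0"
  using vanish'[of "[Gen_v, Gen_u, Gen_u, Gen_u, Gen_v, Gen_v, Gen_u, Gen_u]"] by (simp add: algebra_simps)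

lemma vuuuuvuv: "a1 * p7 + a2 * p7 + a4 * p2 + b2 * p7 = 0"
  using vanish'[of "[Gen_v, Gen_u, Gen_u, Gen_u, Gen_u, Gen_v, Gen_u, Gen_v]"] by (simp add: algebra_simps)

lemma uuvuvvuu: "a2 * p6 + b2 * p6 + b3 * p3 + b6 * p2 = 0"
  using vanish'[of "[Gen_u, Gen_u, Gen_v, Gen_u, Gen_v, Gen_v, Gen_u, Gen_u]"] by (simp add: algebra_simps)

lemma uuvvuvuu: "a3 * p3 + b1 * p9 + b3 * p6 + b5 * p3 = 0"
  using vanish'[of "[Gen_u, Gen_u, Gen_v, Gen_v, Gen_u, Gen_v, Gen_u, Gen_u]"] by (simp add: algebra_simps)

lemma uuuvuvuv: "a1 * p2 + a2 * p2 + b2 * p1 + b2 * p2 + b5 * p1 = 0"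
  using vanish'[of "[Gen_u, Gen_u, Gen_u, Gen_v, Gen_u, Gen_v, Gen_u, Gen_v]"] by (simp add: algebra_simps)

lemma vuvuvuuu: "a3 * p9 + a4 * p9 + b2 * p10 + b5 * p10 + b5 * p9 = 0"
  using vanish'[of "[Gen_v, Gen_u, Gen_v, Gen_u, Gen_v, Gen_u, Gen_u, Gen_u]"] by (simp add: algebra_simps)

lemma uvuuvuuv: "a2 * p4 + 2 * a3 * p4 + 2 * b4 * p4 = 0"
  using vanish'[of "[Gen_u, Gen_v, Gen_u, Gen_u, Gen_v, Gen_u, Gen_u, Gen_v]"] by (simp add: algebra_simps)

lemma vuuvuuvu: "2 * a2 * p8 + a3 * p8 + 2 * b4 * p8 = 0"
  using vanish'[of "[Gen_v, Gen_u, Gen_u, Gen_v, Gen_u, Gen_u, Gen_v, Gen_u]"] by (simp add: algebra_simps)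

lemma vuuuuuvv: "a1 * p7 + a4 * p1 + b1 * p7 = 0"
  using vanish'[of "[Gen_v, Gen_u, Gen_u, Gen_u, Gen_u, Gen_u, Gen_v, Gen_v]"] by (simp add: algebra_simps)

lemma uuvuvuvu: "a2 * p5 + b2 * p3 + b2 * p5 + b5 * p2 + b5 * p3 = 0"
  using vanish'[of "[Gen_u, Gen_u, Gen_v, Gen_u, Gen_v, Gen_u, Gen_v, Gen_u]"] by (simp add: algebra_simps)

lemma uvuuvuvu: "a2 * p5 + a3 * p5 + b2 * p5 + b4 * p5 + b5 * p4 = 0"
  using vanish'[of "[Gen_u, Gen_v, Gen_u, Gen_u, Gen_v, Gen_u, Gen_v, Gen_u]"] by (simp add: algebra_simps)

lemma uvuvuuvu: "a2 * p5 + a3 * p5 + b2 * p8 + b4 * p5 + b5 * p5 = 0"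
  using vanish'[of "[Gen_u, Gen_v, Gen_u, Gen_v, Gen_u, Gen_u, Gen_v, Gen_u]"] by (simp add: algebra_simps)

lemma uvuvuvuu: "a3 * p5 + b2 * p6 + b2 * p9 + b5 * p5 + b5 * p6 = 0"
  using vanish'[of "[Gen_u, Gen_v, Gen_u, Gen_v, Gen_u, Gen_v, Gen_u, Gen_u]"] by (simp add: algebra_simps)

lemma vuuvuvuu: "a2 * p9 + a3 * p8 + b2 * p9 + b4 * p9 + b5 * p8 = 0"
  using vanish'[of "[Gen_v, Gen_u, Gen_u, Gen_v, Gen_u, Gen_v, Gen_u, Gen_u]"] by (simp add: algebra_simps)

lemma vuvuuvuu: "a2 * p9 + 2 * a3 * p9 + b4 * p9 + b5 * p9 = 0"
  using vanish'[of "[Gen_v, Gen_u, Gen_v, Gen_u, Gen_u, Gen_v, Gen_u, Gen_u]"] by (simp add: algebra_simps)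

lemma vuvuuuvu: "a1 * p9 + a2 * p9 + a3 * p8 + a4 * p8 + b5 * p8 = 0"
  using vanish'[of "[Gen_v, Gen_u, Gen_v, Gen_u, Gen_u, Gen_u, Gen_v, Gen_u]"] by (simp add: algebra_simps)

section \<open>Words of length seven\<close>

lemma uvuvuuv: "a3 * q2 + b2 * q4 + b4 * q2 + b5 * q2 + c1 * p5 + 2 * c2 * p4 + c3 * p4 + d2 * p4 = 0"
  using vanish'[of "[Gen_u, Gen_v, Gen_u, Gen_v, Gen_u, Gen_u, Gen_v]"] by (simp add: algebra_simps)

lemma vuuvuvu: "a2 * q5 + b2 * q5 + b4 * q5 + b5 * q4 + c1 * p8 + 2 * c2 * p8 + c3 * p5 + d2 * p8 = 0"
  using vanish'[of "[Gen_v, Gen_u, Gen_u, Gen_v, Gen_u, Gen_v, Gen_u]"] by (simp add: algebra_simps)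

lemma vuuvvuu: "b1 * q6 + b3 * q5 + b4 * q6 + b6 * q4 + c1 * p9 + c3 * p6 + c3 * p8 + d1 * p9 + d3 * p8 = 0"
  using vanish'[of "[Gen_v, Gen_u, Gen_u, Gen_v, Gen_v, Gen_u, Gen_u]"] by (simp add: algebra_simps)

lemma uuvuuvv: "a2 * q1 + a3 * q1 + b1 * q1 + b4 * q1 + c1 * p1 + c1 * p2 + c2 * p1 + c3 * p1 + d1 * p2 = 0"
  using vanish'[of "[Gen_u, Gen_u, Gen_v, Gen_u, Gen_u, Gen_v, Gen_v]"] by (simp add: algebra_simps)

lemma vuvuuvu: "a2 * q5 + a3 * q5 + b4 * q5 + b5 * q5 + c1 * p9 + c2 * p8 + c2 * p9 + c3 * p8 + d2 * p8 = 0"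
  using vanish'[of "[Gen_v, Gen_u, Gen_v, Gen_u, Gen_u, Gen_v, Gen_u]"] by (simp add: algebra_simps)

lemma uvuuvvu: "a3 * q3 + b1 * q3 + b3 * q2 + b4 * q3 + c1 * p5 + c2 * p3 + c3 * p3 + d1 * p5 + d3 * p4 = 0"
  using vanish'[of "[Gen_u, Gen_v, Gen_u, Gen_u, Gen_v, Gen_v, Gen_u]"] by (simp add: algebra_simps)

lemma uvuuvuv: "a2 * q2 + a3 * q2 + b2 * q2 + b4 * q2 + c1 * p4 + c2 * p2 + c2 * p4 + c3 * p2 + d2 * p4 = 0"
  using vanish'[of "[Gen_u, Gen_v, Gen_u, Gen_u, Gen_v, Gen_u, Gen_v]"] by (simp add: algebra_simps)

lemma vuuvuuv: "a2 * q4 + a3 * q4 + 2 * b4 * q4 + c1 * p7 + c1 * p8 + c2 * p7 + c3 * p4 + c3 * p7 = 0"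
  using vanish'[of "[Gen_v, Gen_u, Gen_u, Gen_v, Gen_u, Gen_u, Gen_v]"] by (simp add: algebra_simps)

section \<open>Words of length six, five and four\<close>

lemma vuuvuv: "a2 * s2 + b2 * s2 + b4 * s2 + c1 * q4 + c2 * q4 + c3 * q2 + d2 * q4 + e1 * p7 + e1 * p8 + e2 * p2 + e2 * p7 = 0"
  using vanish'[of "[Gen_v, Gen_u, Gen_u, Gen_v, Gen_u, Gen_v]"] by (simp add: algebra_simps)

lemma uvvuvu: "b3 * s3 + b5 * s1 + c2 * q3 + d1 * q5 + d2 * q3 + d3 * q3 + e1 * p5 + e1 * p6 + e2 * p5 + e2 * p6 - p5 = 0"
  using vanish'[of "[Gen_u, Gen_v, Gen_v, Gen_u, Gen_v, Gen_u]"] by (simp add: algebra_simps)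

lemma vuvvuu: "b3 * s3 + b6 * s2 + c3 * q5 + d1 * q6 + d2 * q6 + d3 * q5 + e1 * p9 + e2 * p6 + e2 * p9 - p9 = 0"
  using vanish'[of "[Gen_v, Gen_u, Gen_v, Gen_v, Gen_u, Gen_u]"] by (simp add: algebra_simps)

lemma vuvuuu: "a3 * r3 + a4 * r3 + b5 * r3 + f1 * p10 + f2 * p10 + f2 * p9 - 2 * \<kappa>\<^sub>1 * p9 = 0"
  using vanish'[of "[Gen_v, Gen_u, Gen_v, Gen_u, Gen_u, Gen_u]"] by (simp add: algebra_simps)

lemma vuuvvu: "b1 * s3 + b3 * s2 + b4 * s3 + c1 * q5 + c3 * q3 + d1 * q5 + d3 * q4 + e1 * p8 + e2 * p3 + e2 * p8 - p8 = 0"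
  using vanish'[of "[Gen_v, Gen_u, Gen_u, Gen_v, Gen_v, Gen_u]"] by (simp add: algebra_simps)

lemma vuuuvu: "a1 * r3 + a2 * r3 + a4 * r2 + f1 * p8 + f2 * p7 + f2 * p8 - 2 * \<kappa>\<^sub>1 * p8 = 0"
  using vanish'[of "[Gen_v, Gen_u, Gen_u, Gen_u, Gen_v, Gen_u]"] by (simp add: algebra_simps)

lemma vuvuuv: "a3 * s2 + b4 * s2 + b5 * s2 + c1 * q5 + c2 * q4 + c3 * q4 + d2 * q4 + e1 * p7 + e1 * p9 + e2 * p4 + e2 * p7 = 0"
  using vanish'[of "[Gen_v, Gen_u, Gen_v, Gen_u, Gen_u, Gen_v]"] by (simp add: algebra_simps)

lemma vuvvu: "d1 * s3 + d2 * s3 + d3 * s2 + e1 * q5 + e2 * q3 + e2 * q5 - q5 = 0"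
  using vanish'[of "[Gen_v, Gen_u, Gen_v, Gen_v, Gen_u]"] by (simp add: algebra_simps)

lemma uvvv: "e1 * s1 - 2 * s1 = 0"
  using vanish'[of "[Gen_u, Gen_v, Gen_v, Gen_v]"] by (simp add: algebra_simps)

lemma vvvu: "e2 * s3 - 2 * s3 = 0"
  using vanish'[of "[Gen_v, Gen_v, Gen_v, Gen_u]"] by (simp add: algebra_simps)

lemma uuvu: "f1 * r2 + f2 * r1 + \<kappa>\<^sub>3 * p2 + 2 * \<kappa>\<^sub>3 * p3 + \<kappa>\<^sub>3 * p5 + \<kappa>\<^sub>3 * p8 - a2 * \<kappa>\<^sub>3 - \<kappa>\<^sub>1 * r2 = 0"
  using vanish'[of "[Gen_u, Gen_u, Gen_v, Gen_u]"] by (simp add: algebra_simps)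

section \<open>Coefficients of \<open>z\<close>: unbalanced words determine \<open>J\<close>,
  balanced words restrict the system\<close>

lemma z_uuuvv: "a1 * w1 + b1 * w1 + \<kappa>\<^sub>4 * p1 = 0"
  using vanish'[of "[Gen_u, Gen_u, Gen_u, Gen_v, Gen_v]"] by (simp add: algebra_simps)

lemma z_uuvuv: "a2 * w1 + b2 * w1 + \<kappa>\<^sub>4 * p2 = 0"
  using vanish'[of "[Gen_u, Gen_u, Gen_v, Gen_u, Gen_v]"] by (simp add: algebra_simps)

lemma z_uuvvu: "b1 * w2 + b3 * w1 + \<kappa>\<^sub>4 * p3 = 0"
  using vanish'[of "[Gen_u, Gen_u, Gen_v, Gen_v, Gen_u]"] by (simp add: algebra_simps)

lemma z_uvuuv: "a3 * w1 + b4 * w1 + \<kappa>\<^sub>4 * p4 = 0"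
  using vanish'[of "[Gen_u, Gen_v, Gen_u, Gen_u, Gen_v]"] by (simp add: algebra_simps)

lemma z_uvuvu: "b2 * w2 + b5 * w1 + \<kappa>\<^sub>4 * p5 = 0"
  using vanish'[of "[Gen_u, Gen_v, Gen_u, Gen_v, Gen_u]"] by (simp add: algebra_simps)

lemma z_uvvuu: "b3 * w2 + b6 * w1 + \<kappa>\<^sub>4 * p6 = 0"
  using vanish'[of "[Gen_u, Gen_v, Gen_v, Gen_u, Gen_u]"] by (simp add: algebra_simps)

lemma z_vuuuv: "a1 * w2 + a4 * w1 + \<kappa>\<^sub>4 * p7 = 0"
  using vanish'[of "[Gen_v, Gen_u, Gen_u, Gen_u, Gen_v]"] by (simp add: algebra_simps)

lemma z_vuuvu: "a2 * w2 + b4 * w2 + \<kappa>\<^sub>4 * p8 = 0"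
  using vanish'[of "[Gen_v, Gen_u, Gen_u, Gen_v, Gen_u]"] by (simp add: algebra_simps)

lemma z_vuvuu: "a3 * w2 + b5 * w2 + \<kappa>\<^sub>4 * p9 = 0"
  using vanish'[of "[Gen_v, Gen_u, Gen_v, Gen_u, Gen_u]"] by (simp add: algebra_simps)

lemma z_vvuuu: "a4 * w2 + b6 * w2 + \<kappa>\<^sub>4 * p10 = 0"
  using vanish'[of "[Gen_v, Gen_v, Gen_u, Gen_u, Gen_u]"] by (simp add: algebra_simps)

lemma z_uuv: "f1 * w1 + \<kappa>\<^sub>4 * r1 - \<kappa>\<^sub>1 * w1 = 0"
  using vanish'[of "[Gen_u, Gen_u, Gen_v]"] by (simp add: algebra_simps)

lemma z_uvu: "f1 * w2 + f2 * w1 + \<kappa>\<^sub>4 * r2 = 0"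
  using vanish'[of "[Gen_u, Gen_v, Gen_u]"] by (simp add: algebra_simps)

lemma z_uvv: "e1 * w1 - \<kappa>\<^sub>4 * s1 - w1 = 0"
  using vanish'[of "[Gen_u, Gen_v, Gen_v]"] by (simp add: algebra_simps)

lemma z_vuv: "e1 * w2 + e2 * w1 - \<kappa>\<^sub>4 * s2 = 0"
  using vanish'[of "[Gen_v, Gen_u, Gen_v]"] by (simp add: algebra_simps)

lemma z_vvu: "e2 * w2 - \<kappa>\<^sub>4 * s3 - w2 = 0"
  using vanish'[of "[Gen_v, Gen_v, Gen_u]"] by (simp add: algebra_simps)

lemma z_uuvv: "c1 * w1 + d1 * w1 = 0"
  using vanish'[of "[Gen_u, Gen_u, Gen_v, Gen_v]"] by (simp add: algebra_simps)

lemma z_uvuv: "c2 * w1 + d2 * w1 = 0"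
  using vanish'[of "[Gen_u, Gen_v, Gen_u, Gen_v]"] by (simp add: algebra_simps)

lemma z_vuuv: "c1 * w2 + c3 * w1 = 0"
  using vanish'[of "[Gen_v, Gen_u, Gen_u, Gen_v]"] by (simp add: algebra_simps)

lemma z_uvvu: "d1 * w2 + d3 * w1 = 0"
  using vanish'[of "[Gen_u, Gen_v, Gen_v, Gen_u]"] by (simp add: algebra_simps)

lemma z_vuvu: "c2 * w2 + d2 * w2 = 0"
  using vanish'[of "[Gen_v, Gen_u, Gen_v, Gen_u]"] by (simp add: algebra_simps)

lemma z_vvuu: "c3 * w2 + d3 * w2 = 0"
  using vanish'[of "[Gen_v, Gen_v, Gen_u, Gen_u]"] by (simp add: algebra_simps)

section \<open>Solving the coefficient equations\<close>

text \<open>Words of length eight reduce the leading part of \<open>J\<close> to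
  \<open>uvuvu\<close>. Shorter words then give \<open>c1 = c3 = - 1\<close>, against
  \<open>z_vuuv\<close>.\<close>

lemma w1_or_w2_zero: "w1 = 0 \<or> w2 = 0"
proof (rule ccontr)
  assume "\<not> (w1 = 0 \<or> w2 = 0)"
  then have w: "w1 \<noteq> 0" "w2 \<noteq> 0" by auto
  have "w1 * (a1 + b1)^2 = 0"
    using uuuuuvvv z_uuuvv by algebra
  then have b1: "b1 = - a1"
    using w by (simp add: eq_neg_iff_add_eq_0 add.commute)
  have "w2 * (a4 + b6)^2 = 0"
    using vvvuuuuu z_vvuuu by algebra
  then have b6: "b6 = - a4"
    using w by (simp add: eq_neg_iff_add_eq_0 add.commute)
  have p1: "p1 = 0" and p10: "p10 = 0"
    using z_uuuvv z_vvuuu b1 b6 nonzero(3) by simp_all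
  have b3: "b3 = 0"
  \<comment> \<open>With \<open>b1 = - a1\<close>, \<open>b6 = - a4\<close> and
    \<open>p1 = p10 = 0\<close>, four words of length eight become \<open>b3\<close> times
    \<open>p2\<close>, \<open>p3\<close>, \<open>p9\<close>, \<open>p6\<close>.\<close>
  proof (rule ccontr)
    assume "b3 \<noteq> 0"
    then have p: "p2 = 0" "p3 = 0" "p9 = 0" "p6 = 0"
      using uuuvvuuv uuuvvuvu vuuvvuuu uvuvvuuu b1 b6 p1 p10 by simp_all
    \<comment> \<open>The second equation is the sum of \<open>z_uuvvu\<close>,
      \<open>z_uvvuu\<close> and \<open>z_vuuuv\<close>, in which \<open>a1 + b1\<close> and
      \<open>a4 + b6\<close> cancel.\<close>
    have "w1 * (a2 + b2) = 0" "\<kappa>\<^sub>4 * (p7 + b3) = 0"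
      using z_uuvuv z_uuvvu z_uvvuu z_vuuuv w_sum p b1 b6 by algebra+
    then have "b2 = - a2" "p7 = - b3"
      using w nonzero(3) by (simp_all add: eq_neg_iff_add_eq_0 add.commute)
    then have "a1 = 0"
      using vuuuuvuv p \<open>b3 \<noteq> 0\<close> by simp
    then show False
      using z_uuvvu p b1 w \<open>b3 \<noteq> 0\<close> by simp
  qed
  \<comment> \<open>After multiplication by \<open>\<kappa>\<^sub>4\<close>, the linear equations
    for \<open>p2\<close> and \<open>p6\<close> make the two remaining terms of
    \<open>uuvuvvuu\<close>, \<open>(a2 + b2) * p6\<close> and \<open>b6 * p2\<close>, equal. The
    same happens with \<open>uuvvuvuu\<close> below.\<close>
  have "2 * \<kappa>\<^sub>4 * (b6 * p2) = 0"
    using uuvuvvuu z_uuvuv z_uvvuu b3 by algebra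
  then have b6_p2: "b6 * p2 = 0"
    using nonzero by simp
  have "2 * \<kappa>\<^sub>4 * (b1 * p9) = 0"
    using uuvvuvuu z_vuvuu z_uuvvu b3 by algebra
  then have b1_p9: "b1 * p9 = 0"
    using nonzero by simp
  have 1: "b1 * (2 * w2 * b1 + w1 * b6) = 0"
    using uuvvuuuv z_uuvvu z_vuuuv b1 b6 b3 b6_p2 by algebra
  have 2: "b6 * (w2 * b1 + 2 * w1 * b6) = 0"
    using vuuuvvuu z_uvvuu z_vuuuv b1 b6 b3 b1_p9 by algebra
  \<comment> \<open>Eliminates \<open>w1\<close>: twice \<open>b6\<close> times (1), minus
    \<open>b1\<close> times (2).\<close>
  have "3 * (b1^2 * b6 * w2) = 0"
    using 1 2 by algebra
  then have "b1 * b6 = 0"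
    using nonzero w by simp
  with 1 2 have "b1 = 0" "b6 = 0"
    using nonzero w by auto
  with b1 b6 have a1: "a1 = 0" and a4: "a4 = 0" and b1: "b1 = 0" and b6: "b6 = 0"
    by simp_all
  have "w1 * (a2 + b2)^2 = 0"
    using uuuvuvuv z_uuvuv a1 p1 by algebra
  then have b2: "b2 = - a2"
    using w by (simp add: eq_neg_iff_add_eq_0 add.commute)
  have "w2 * (a3 + b5)^2 = 0"
    using vuvuvuuu z_vuvuu a4 p10 by algebra
  then have b5: "b5 = - a3"
    using w by (simp add: eq_neg_iff_add_eq_0 add.commute)
  have a2: "a2 = 2 - a3"
    using a_sum a1 a4 by (simp add: eq_diff_eq)
  have "b4 + 1 = 0"
    using b_sum a2 b1 b2 b3 b5 b6 by algebra
  then have b4: "b4 = - 1"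
    by (simp add: eq_neg_iff_add_eq_0)
  \<comment> \<open>The two words give \<open>a3 * (a3 - 1) = 0\<close> and
    \<open>(a3 - 2) * (a3 - 1) = 0\<close>, up to the factors \<open>w1\<close> and
    \<open>w2\<close>; the difference is \<open>2 * (a3 - 1)\<close>.\<close>
  have "2 * (w1 * w2 * (a3 - 1)) = 0"
    using uvuuvuuv vuuvuuvu z_uvuuv z_vuuvu a2 b4 by algebra
  then have a3: "a3 = 1"
    using nonzero w by simp
  have p: "p2 = 0" "p3 = 0" "p4 = 0" "p6 = 0" "p7 = 0" "p8 = 0" "p9 = 0"
    using z_uuvuv z_uuvvu z_uvuuv z_uvvuu z_vuuuv z_vuuvu z_vuvuu nonzero(3)
    by (simp_all add: a1 a2 a3 a4 b1 b2 b3 b4 b5 b6)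
  have "\<kappa>\<^sub>4 * (p5 - 1) = 0"
    using z_uvuvu a2 a3 b2 b5 w_sum by algebra
  then have p5: "p5 = 1"
    using nonzero(3) by simp
  have d: "d1 = - c1" "d2 = - c2" "d3 = - c3"
    using z_uuvv z_uvuv z_vvuu w
    by (simp_all add: eq_neg_iff_add_eq_0 add.commute flip: distrib_right)
  \<comment> \<open>Same pattern: \<open>e1 - 1\<close> is annihilated by both \<open>e1 - 2\<close>
    and \<open>e1\<close>.\<close>
  have "2 * (w1 * w2 * (e1 - 1)) = 0"
    using uvvv vvvu z_uvv z_vvu e_sum by algebra
  then have e1: "e1 = 1" and e2: "e2 = 1"
    using nonzero w e_sum by auto
  have s: "s1 = 0" "s3 = 0"
    using z_uvv z_vvu e1 e2 nonzero(3) by simp_all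
  then have s2: "s2 = 1"
    using s_sum by simp
  note subst = a1 a2 a3 a4 b1 b2 b3 b4 b5 b6 p1 p p5 p10 d e1 e2 s s2
  have q: "q1 = 0" "q6 = 0"
    using uuvuuvv vuuvvuu by (simp_all add: subst)
  have eqs: "c1 - q2 - q4 = 0" "c3 - q4 - q5 = 0" "c1 * q4 + c3 * q2 - 1 = 0"
    "1 - c3 * q3 - c1 * q5 = 0" "q3 + q5 - c3 = 0"
    using uvuvuuv vuuvuvu vuuvuv uvvuvu vuvvu
    by (simp_all add: subst algebra_simps)
  \<comment> \<open>The equations give \<open>c1 = q2 + q4\<close>, \<open>c3 = q4 + q5\<close> and
    \<open>q3 = q4\<close>. The first claim is then \<open>q_sum\<close>, and adding the two
    inhomogeneous equations gives \<open>2 * c1 * c3 = 2\<close>.\<close>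
  have c: "c1 + c3 = - 2" "2 * (c1 * c3 - 1) = 0"
    using eqs q_sum q by algebra+
  then have "c1 * c3 = 1"
    using nonzero by simp
  with c(1) have "(c1 + 1)^2 = 0" "(c3 + 1)^2 = 0"
    by algebra+
  then have "c1 = - 1" "c3 = - 1"
    by (simp_all add: eq_neg_iff_add_eq_0)
  \<comment> \<open>Here \<open>z_vuuv\<close> reads \<open>- (w1 + w2) = 0\<close>, but
    \<open>w1 + w2\<close> is \<open>\<kappa>\<^sub>4\<close>.\<close>
  then show False
    using z_vuuv w_sum nonzero(3) by algebra
qed

end

text \<open>The rows are the coefficients \<open>(a\<^sub>1, \<dots>, a\<^sub>4, b\<^sub>1, \<dots>, b\<^sub>6, c\<^sub>1, \<dots>, c\<^sub>3, d\<^sub>1, \<dots>, d\<^sub>3, e\<^sub>1, e\<^sub>2, f\<^sub>1, f\<^sub>2)\<close>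
  of the systems (1), (2), (3), (4), (6); reversing words turns them into (7), (8), (9), (10), (5).\<close>

definition solution_table where
  "solution_table (\<kappa> :: 'k::field) \<theta> =
    [(0, 0, 2, 0, 0, 0, 0, - 1, - 2, 0, 0, - 2, - 2, 0, 2, 2, 0, 2, (\<kappa> + \<theta>) / 2, (3 * \<kappa> - \<theta>) / 2),
     (0, 0, 2, 0, 0, 0, 0, - 1, - 2, 0, 0, - 3, - 1, 0, 3, 1, 1, 1, (\<kappa> + \<theta>) / 2, (3 * \<kappa> - \<theta>) / 2),
     (0, 0, 1, 1, 0, 0, 0, 0, - 2, - 1, 0, - 2, - 2, 0, 2, 2, 1, 1, 0, 2 * \<kappa>),
     (0, 0, 1, 1, 0, 0, 0, 0, - 2, - 1, 0, - 1, - 3, 0, 1, 3, 0, 2, 0, 2 * \<kappa>),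
     (0, 1, 1, 0, 0, - 1, 0, - 1, - 1, 0, 0, - 3, - 1, 0, 3, 1, 0, 2, \<kappa>, \<kappa>)]"

context integral_coefficients begin

section \<open>The case \<open>w1 = 0\<close>\<close>

context
  assumes w1: "w1 = 0"
begin

lemma w2: "w2 = \<kappa>\<^sub>4"
  using w_sum w1 by simp

lemma p_eqs:
  "p1 = 0" "p2 = 0" "p3 = - b1" "p4 = 0" "p5 = - b2" "p6 = - b3" "p7 = - a1"
  "p8 = - (a2 + b4)" "p9 = - (a3 + b5)" "p10 = - (a4 + b6)"
proof -
  have "\<kappa>\<^sub>4 * (p3 + b1) = 0" "\<kappa>\<^sub>4 * (p5 + b2) = 0" "\<kappa>\<^sub>4 * (p6 + b3) = 0" "\<kappa>\<^sub>4 * (p7 + a1) = 0"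
    "\<kappa>\<^sub>4 * (p8 + (a2 + b4)) = 0" "\<kappa>\<^sub>4 * (p9 + (a3 + b5)) = 0" "\<kappa>\<^sub>4 * (p10 + (a4 + b6)) = 0"
    using z_uuvvu z_uvuvu z_uvvuu z_vuuuv z_vuuvu z_vuvuu z_vvuuu
    by (simp_all add: w1 w2 algebra_simps)
  then show "p3 = - b1" "p5 = - b2" "p6 = - b3" "p7 = - a1"
    "p8 = - (a2 + b4)" "p9 = - (a3 + b5)" "p10 = - (a4 + b6)"
    using nonzero(3) by (simp_all only: mult_eq_0_iff eq_neg_iff_add_eq_0) simp_all
  show "p1 = 0" "p2 = 0" "p4 = 0"
    using z_uuuvv z_uuvuv z_uvuuv nonzero(3) by (simp_all add: w1)
qed

lemma lower_eqs:
  "c1 = 0" "d1 = 0" "d2 = - c2" "d3 = - c3" "s1 = 0" "s2 = e1" "r1 = 0" "r2 = - f1"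
  "c2 = - 4 - c3" "e2 = 2 - e1" "s3 = 1 - e1" "f2 = 2 * \<kappa>\<^sub>1 - f1"
proof -
  show "c1 = 0" "d1 = 0" "d2 = - c2" "d3 = - c3"
    using z_vuuv z_uvvu z_vuvu z_vvuu nonzero(3)
    by (simp_all add: w1 w2 eq_neg_iff_add_eq_0 add.commute flip: distrib_right)
  then show "c2 = - 4 - c3"
    using c_sum by (simp add: eq_diff_eq)
  have "\<kappa>\<^sub>4 * (s2 - e1) = 0" "\<kappa>\<^sub>4 * (r2 + f1) = 0"
    using z_vuv z_uvu w1 w2 by algebra+
  then show "s2 = e1" "r2 = - f1"
    using nonzero(3) by (simp_all add: eq_neg_iff_add_eq_0)
  show "s1 = 0" "r1 = 0"
    using z_uvv z_uuv nonzero(3) by (simp_all add: w1)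
  with \<open>s2 = e1\<close> show "s3 = 1 - e1"
    using s_sum by (simp add: eq_diff_eq add.commute)
  show "e2 = 2 - e1" "f2 = 2 * \<kappa>\<^sub>1 - f1"
    using e_sum f_sum by (simp_all add: eq_diff_eq add.commute)
qed

text \<open>By \<open>lower_eqs\<close>, \<open>vvvu\<close> becomes
  \<open>- e1 * (1 - e1) = 0\<close>.\<close>

lemma e1_cases: "e1 = 0 \<or> e1 = 1"
proof -
  have "e1 * (e1 - 1) = 0"
    using vvvu by (simp add: lower_eqs algebra_simps)
  then show ?thesis
    by simp
qed

text \<open>Once \<open>p_eqs\<close> is inserted, suitable equations of length eight are, up to
  sign, squares or combine to multiples of squares.\<close>

lemma top_zero: "a1 = 0" "b1 = 0" "b3 = 0" "b6 = - a4"
proof -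
  have "(a1 + b1)^2 = 0"
    using uuuuvvvu vuuuuuvv p_eqs by algebra
  then have b1: "b1 = - a1"
    by (simp add: eq_neg_iff_add_eq_0 add.commute)
  have "2 * a1^2 = 0"
    using uuvvuuuv p_eqs b1 by algebra
  then show a1: "a1 = 0" and b1: "b1 = 0"
    using nonzero b1 by simp_all
  have "b3^2 = 0"
    using uuvvuvuu p_eqs b1 by algebra
  then show "b3 = 0"
    by simp
  have "(a4 + b6)^2 = 0"
    using vvvuuuuu p_eqs by algebra
  then show "b6 = - a4"
    by (simp add: eq_neg_iff_add_eq_0 add.commute)
qed

text \<open>Makes \<open>p5\<close>, \<open>p8\<close>, \<open>p9\<close>, \<open>a3\<close>,
  \<open>a4\<close> the remaining leading unknowns. The sum is \<open>1\<close> because the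
  \<open>p\<close>s are minus sums of \<open>a\<close>s and \<open>b\<close>s, whose totals are
  \<open>2\<close> and \<open>- 3\<close>.\<close>

lemma top_eqs:
  "p3 = 0" "p6 = 0" "p7 = 0" "p10 = 0" "b2 = - p5" "b4 = - p8 - a2" "b5 = - p9 - a3"
  "p5 + p8 + p9 = 1" "a2 = 2 - a3 - a4"
proof -
  show "p3 = 0" "p6 = 0" "p7 = 0" "p10 = 0"
    by (simp_all add: p_eqs top_zero)
  show *: "b2 = - p5" "b4 = - p8 - a2" "b5 = - p9 - a3" "a2 = 2 - a3 - a4"
    using a_sum by (simp_all add: p_eqs top_zero eq_diff_eq add_ac)
  have "- 1 - (p5 + p8 + p9) = - 2"
    using b_sum unfolding * top_zero by algebra
  then show "p5 + p8 + p9 = 1"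
    by algebra
qed

lemma top_cases:
  "p5 = 0 \<and> p8 = 1 \<and> p9 = 0 \<and> a3 = 2 \<and> a4 = 0 \<or>
   p5 = 0 \<and> p8 = 0 \<and> p9 = 1 \<and> a3 = 1 \<and> a4 = 1 \<or>
   p5 = 1 \<and> p8 = 0 \<and> p9 = 0 \<and> a3 = 1 \<and> a4 = 0"
proof -
  \<comment> \<open>Since \<open>b2 = - p5\<close> and \<open>a3 + b5 = - p9\<close>, both nonzero
    terms of \<open>uvuvuvuu\<close> are \<open>- p5 * p9\<close>. The other two words are similar,
    with \<open>a2 + b4 = - p8\<close>.\<close>
  have "2 * (p5 * p9) = 0"
    using uvuvuvuu p_eqs top_zero by algebra
  then have "p5 * p9 = 0"
    using nonzero by simp
  moreover from this have "2 * (p5 * p8) = 0" "2 * (p8 * p9) = 0"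
    using uvuvuuvu vuuvuvuu p_eqs top_zero by algebra+
  then have "p5 * p8 = 0" "p8 * p9 = 0"
    using nonzero by simp_all
  ultimately consider "p5 = 0" "p8 = 0" "p9 = 1" | "p5 = 0" "p8 = 1" "p9 = 0" | "p5 = 1" "p8 = 0" "p9 = 0"
    using top_eqs(8) by auto
  then show ?thesis
  proof cases
    case 1
    have "a4 = 1"
      using vuvuvuuu by (simp add: top_eqs top_zero 1)
    moreover have "a3 = 1"
      using vuvuuvuu by (simp add: top_eqs top_zero 1)
    ultimately show ?thesis
      by (simp add: 1)
  next
    case 2
    have "a4 = 0"
      using vuvuuuvu by (simp add: top_eqs top_zero 2)
    moreover have "a3 = 2"
      using vuuvuuvu by (simp add: top_eqs top_zero 2)
    ultimately show ?thesis
      by (simp add: 2)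
  next
    case 3
    have "a2 = 1" "a3 = 1"
      using uuvuvuvu uvuuvuvu by (simp_all add: top_eqs(1,5,6) top_zero p_eqs(2,4) 3)
    then show ?thesis
      using top_eqs(9) by (simp add: 3)
  qed
qed

text \<open>The assumed root supplies \<open>\<theta>\<close> for the rows free of it; for the first
  two rows \<open>\<theta>\<close> is computed from \<open>f1\<close>.\<close>

lemma solution:
  assumes "\<exists>\<theta>. \<theta>^2 = \<kappa>\<^sub>1^2 + 4 * \<kappa>\<^sub>3"
  shows "\<exists>\<theta>. \<theta>^2 = \<kappa>\<^sub>1^2 + 4 * \<kappa>\<^sub>3 \<and>
    (a1, a2, a3, a4, b1, b2, b3, b4, b5, b6, c1, c2, c3, d1, d2, d3, e1, e2, f1, f2)
      \<in> set (solution_table \<kappa>\<^sub>1 \<theta>)"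
  using top_cases
proof (elim disjE conjE)
  assume p: "p5 = 0" "p8 = 1" "p9 = 0" and a: "a3 = 2" "a4 = 0"
  then have ab: "a2 = 0" "b2 = 0" "b4 = - 1" "b5 = - 2"
    by (simp_all add: top_eqs)
  note subst = p a ab lower_eqs top_zero top_eqs(1-4) p_eqs(1,2,4)
  have q: "q1 = 0" "q2 = 0" "q3 = 0" "q6 = 0" "q5 = c3"
    using uuvuuvv uvuuvuv uvuuvvu vuuvvuu vuvuuvu
    by (simp_all add: subst algebra_simps)
  have q4: "q4 = - 2 - c3"
    using q_sum q by (simp add: eq_diff_eq)
  have "2 * ((2 + c3) * (1 - e1)) = 0" "c3^2 + 2 * c3 + e1 = 0"
    using vuvvu vuuvvu by (simp_all add: subst q q4 algebra_simps power2_eq_square)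
  then have "(2 + c3) * (1 - e1) = 0" "c3^2 + 2 * c3 + e1 = 0"
    using nonzero by simp_all
  moreover have "(c3 + 1)^2 = 0" if "c3^2 + 2 * c3 + 1 = 0"
    using that by algebra
  \<comment> \<open>For \<open>e1 = 0\<close> the product equation gives \<open>c3 = - 2\<close>;
    for \<open>e1 = 1\<close> the quadratic is \<open>(c3 + 1)^2\<close>.\<close>
  ultimately have "e1 = 0 \<and> c3 = - 2 \<or> e1 = 1 \<and> c3 = - 1"
    using e1_cases by (auto simp: eq_neg_iff_add_eq_0 add.commute)
  moreover have "f1^2 = \<kappa>\<^sub>1 * f1 + \<kappa>\<^sub>3"
    using uuvu by (simp add: subst algebra_simps power2_eq_square)
  then have "(2 * f1 - \<kappa>\<^sub>1)^2 = \<kappa>\<^sub>1^2 + 4 * \<kappa>\<^sub>3"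
    by algebra
  ultimately show ?thesis
    using nonzero(1)
    \<comment> \<open>This root satisfies \<open>f1 = (\<kappa>\<^sub>1 + \<theta>) / 2\<close>, the
      entry of the table.\<close>
    by (intro exI[of _ "2 * f1 - \<kappa>\<^sub>1"])
      (auto simp: solution_table_def subst field_simps)
next
  assume p: "p5 = 0" "p8 = 0" "p9 = 1" and a: "a3 = 1" "a4 = 1"
  then have ab: "a2 = 0" "b2 = 0" "b4 = 0" "b5 = - 2"
    by (simp_all add: top_eqs)
  note subst = p a ab lower_eqs top_zero top_eqs(1-4) p_eqs(1,2,4)
  have "- q5 = c3 + 4"
    using vuvuuvu by (simp add: subst algebra_simps)
  then have q5: "q5 = c2"
    using lower_eqs(9) by algebra
  have q: "q1 = 0" "q2 = 0" "q3 = 0" "q4 = 0"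
    using uuvuuvv uvuuvuv uvuuvvu vuuvuuv by (simp_all add: subst)
  have q6: "q6 = - 2 - c2"
    using q_sum q q5 by (simp add: eq_diff_eq add.commute)
  have "f1 = 0"
    using vuvuuu by (simp add: subst algebra_simps)
  have "- (e1 * 4) = c3 * (e1 * 2)"
    using vuvvu by (simp add: subst q q5 algebra_simps)
  then have "2 * (e1 * (c3 + 2)) = 0"
    by algebra
  then have "e1 * (c3 + 2) = 0"
    using nonzero by simp
  moreover have "(c3 + 3)^2 = e1"
    using vuvvuu by (simp add: subst q q5 q6 algebra_simps power2_eq_square)
  ultimately have "e1 = 0 \<and> c3 = - 3 \<or> e1 = 1 \<and> c3 = - 2"
    using e1_cases by (auto simp: eq_neg_iff_add_eq_0)
  then show ?thesis
    using assms by (auto simp: solution_table_def subst \<open>f1 = 0\<close>)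
next
  assume p: "p5 = 1" "p8 = 0" "p9 = 0" and a: "a3 = 1" "a4 = 0"
  then have ab: "a2 = 1" "b2 = - 1" "b4 = - 1" "b5 = - 1"
    by (simp_all add: top_eqs)
  note subst = p a ab lower_eqs top_zero top_eqs(1-4) p_eqs(1,2,4)
  have "- q2 = q4" "c3 = q4 + q5"
    using uvuvuuv vuuvuvu by (simp_all add: subst algebra_simps)
  then have q: "q1 = 0" "q6 = 0" "q4 = - q2" "q5 = c3 + q2"
    using uuvuuvv vuuvvuu by (auto simp: subst)
  have q3: "q3 = - 2 - q2 - c3"
    using q_sum q by (simp add: eq_diff_eq algebra_simps)
  have "r3 = 0"
    using vuuuvu by (simp add: subst)
  then have "f1 = \<kappa>\<^sub>1"
    using r_sum by (simp add: subst)
  have "- e1 = c3 * q2"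
    using vuvuuv by (simp add: subst q algebra_simps)
  moreover have "e1 = c3 * q2"
    using vuuvuv by (simp add: subst q algebra_simps)
  \<comment> \<open>The two words yield \<open>c3 * q2\<close> with opposite signs.\<close>
  ultimately have "2 * e1 = 0"
    by algebra
  then have "e1 = 0"
    using nonzero by simp
  have "c3 * q3 = 1"
    using uvvuvu by (simp add: subst q algebra_simps)
  have "(c3 + 1)^2 = 0"
    using \<open>e1 = 0\<close> \<open>e1 = c3 * q2\<close> \<open>c3 * q3 = 1\<close> q3 by algebra
  then have "c3 = - 1"
    by (simp add: eq_neg_iff_add_eq_0)
  then show ?thesis
    using assms by (auto simp: solution_table_def subst \<open>f1 = \<kappa>\<^sub>1\<close> \<open>e1 = 0\<close>)
qed

end

end

section \<open>The ansatz in terms of tries\<close>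

lemma gen_of_coeff:
  "\<uu> * of_coeff c = of_coeff c * \<uu>" "\<vv> * of_coeff c = of_coeff c * \<vv>"
  "\<uu> * (of_coeff c * x) = of_coeff c * (\<uu> * x)" "\<vv> * (of_coeff c * x) = of_coeff c * (\<vv> * x)"
  by (metis of_coeff_commute mult.assoc)+

lemma gen_zz:
  "\<uu> * \<zz> = \<zz> * \<uu>" "\<vv> * \<zz> = \<zz> * \<vv>"
  "\<uu> * (\<zz> * x) = \<zz> * (\<uu> * x)" "\<vv> * (\<zz> * x) = \<zz> * (\<vv> * x)"
  "\<zz> * of_coeff c = of_coeff c * \<zz>" "\<zz> * (of_coeff c * x) = of_coeff c * (\<zz> * x)"
  by (simp_all add: \<zz>_def gen_of_coeff) (metis of_coeff_commute mult.assoc)+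

lemma of_coeff_linear: "of_coeff [:a, b:] = of_coeff [:a:] + of_coeff [:b:] * \<zz>"
  by (simp add: \<zz>_def flip: of_coeff_add of_coeff_mult)

lemma of_coeff_minus: "of_coeff (- c) = - of_coeff c"
  by (metis add_eq_0_iff of_coeff_0 of_coeff_add right_minus)

lemma of_coeff_const:
  "of_coeff [:- a:] = - of_coeff [:a:]" "of_coeff [:1:] = 1"
  "of_coeff [:a + b:] = of_coeff [:a:] + of_coeff [:b:]"
  "of_coeff [:a - b:] = of_coeff [:a:] - of_coeff [:b:]"
  using of_coeff_minus[of "[:a:]"] of_coeff_add[of "[:a:]" "[:b:]"]
    of_coeff_add[of "[:a:]" "[:- b:]"] of_coeff_minus[of "[:b:]"]
  by (simp_all add: of_coeff_1 flip: one_pCons)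

text \<open>Normal form: sums of right-nested monomials, with central factors moved to the left and
  coefficients split into single parameters.\<close>

lemmas expand_alg =
  scale_alg_def gen_of_coeff gen_zz of_coeff_linear of_coeff_const of_coeff_0
  power3_eq_cube power2_eq_square mult.assoc distrib_left distrib_right diff_conv_add_uminus

lemma sum_upto_5: "(\<Sum>i = 1..5. x i) = x 1 + x 2 + x 3 + x 4 + x (5::nat)" for x :: "nat \<Rightarrow> 'k::field"
  by (simp add: eval_nat_numeral)

lemma sum_upto_9: "(\<Sum>i = 1..9. x i) = x 1 + x 2 + x 3 + x 4 + x 5 + x 6 + x 7 + x 8 + x (9::nat)"
  for x :: "nat \<Rightarrow> 'k::field"
  by (simp add: eval_nat_numeral)

lemma p5_system_eq:
  "p5_system \<kappa>\<^sub>4 (P1_poly \<kappa>\<^sub>1 \<kappa>\<^sub>2 a c e\<^sub>1) (P2_poly \<kappa>\<^sub>1 \<kappa>\<^sub>2 \<kappa>\<^sub>3 b d f\<^sub>1) =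
    (alg_of (field_u \<kappa>\<^sub>1 \<kappa>\<^sub>2 \<kappa>\<^sub>4 (a 1) (a 2) (a 3) (2 - a 1 - a 2 - a 3)
       (c 1) (- 4 - c 1 - c 2) (c 2) e\<^sub>1 (2 - e\<^sub>1)),
     alg_of (field_v \<kappa>\<^sub>1 \<kappa>\<^sub>2 \<kappa>\<^sub>3 \<kappa>\<^sub>4 (b 1) (b 2) (b 3) (b 4) (b 5) (- 3 - (\<Sum>i=1..5. b i))
       (d 1) (4 - d 1 - d 2) (d 2) f\<^sub>1 (2 * \<kappa>\<^sub>1 - f\<^sub>1)))"
  \<comment> \<open>The deleted rules would restore differences, undoing
    \<open>diff_conv_add_uminus\<close>.\<close>
  by (simp add: p5_system_def P1_poly_def P2_poly_def field_u_def field_v_def expand_alg add_ac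
      del: add_uminus_conv_diff uminus_add_conv_diff)

lemma J_poly_eq:
  "J_poly \<kappa>\<^sub>1 \<kappa>\<^sub>2 \<kappa>\<^sub>3 \<kappa>\<^sub>4 p q r s t\<^sub>1 w\<^sub>1 =
    alg_of (integral_ansatz \<kappa>\<^sub>2 \<kappa>\<^sub>3 (p 1) (p 2) (p 3) (p 4) (p 5) (p 6) (p 7) (p 8) (p 9)
      (1 - (\<Sum>i=1..9. p i)) (q 1) (q 2) (q 3) (q 4) (q 5) (- 2 - (\<Sum>i=1..5. q i))
      (r 1) (r 2) (- \<kappa>\<^sub>1 - r 1 - r 2) (s 1) (s 2) (1 - s 1 - s 2)
      t\<^sub>1 (\<kappa>\<^sub>1 + \<kappa>\<^sub>2 - t\<^sub>1) w\<^sub>1 (\<kappa>\<^sub>4 - w\<^sub>1))"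
  by (simp add: J_poly_def integral_ansatz_def expand_alg add_ac
      del: add_uminus_conv_diff uminus_add_conv_diff)

section \<open>Reversal of words\<close>

text \<open>\<open>map_key\<close> precomposes with the key map; as reversing a word is an
  involution, this moves each coefficient to the reversed word.\<close>

definition reversal :: "'k::field free_alg \<Rightarrow> 'k free_alg" where
  "reversal = Poly_Mapping.map_key (\<lambda>w. Word (rev (letters w)))"

lemma lookup_reversal:
  "Poly_Mapping.lookup (reversal x) (Word w) = Poly_Mapping.lookup x (Word (rev w))"
proof -
  have "inj (\<lambda>w. Word (rev (letters w)))"
    by (auto intro!: injI simp: word.expand)
  then show ?thesis
    by (simp add: reversal_def map_key.rep_eq)
qed

lemma word_poly_eqI:
  "(\<And>w. Poly_Mapping.lookup x (Word w) = Poly_Mapping.lookup y (Word w)) \<Longrightarrow> x = (y :: 'k::field free_alg)"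
  by (metis poly_mapping_eqI word.exhaust)

lemma reversal_add: "reversal (x + y) = reversal x + reversal y"
  by (rule word_poly_eqI) (simp add: lookup_reversal lookup_add)

lemma reversal_0: "reversal 0 = 0"
  by (rule word_poly_eqI) (simp add: lookup_reversal)

lemma reversal_mono: "reversal (of_coeff c * word_mono w) = of_coeff c * word_mono (rev w)"
proof -
  have *: "of_coeff c * word_mono w = Poly_Mapping.single (Word w) c" for w
    by (simp add: of_coeff_def mult_single)
  show ?thesis
    by (rule word_poly_eqI) (auto simp: * lookup_reversal lookup_single when_def)
qed

lemma reversal_reversal: "reversal (reversal x) = x"
  by (rule word_poly_eqI) (simp add: lookup_reversal)

lemma mono_mult_mono:
  "of_coeff b * word_mono v * (of_coeff c * word_mono w) = of_coeff (b * c) * word_mono (v @ w)"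
  by (simp add: of_coeff_def mult_single plus_word_def zero_word_def)

text \<open>Reversal turns a concatenation around, and the coefficients in \<open>K[z]\<close>
  commute.\<close>

lemma reversal_mult: "reversal (x * y) = reversal y * reversal x"
proof (induction x rule: free_alg_induct)
  case zero
  then show ?case by (simp add: reversal_0)
next
  case (add b v x)
  have "reversal (of_coeff b * word_mono v * y) = reversal y * (of_coeff b * word_mono (rev v))"
  proof (induction y rule: free_alg_induct)
    case zero
    then show ?case by (simp add: reversal_0)
  next
    case (add c w y)
    then show ?case
      unfolding distrib_left distrib_right reversal_add mono_mult_mono reversal_mono rev_append
      by (simp only: mult.commute)
  qed
  with add show ?case
    unfolding distrib_left distrib_right reversal_add reversal_mono by simp
qed

lemma reversal_of_coeff: "reversal (of_coeff c) = of_coeff c"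
  using reversal_mono[of c "[]"] by (simp add: word_mono_Nil)

lemma reversal_gens: "reversal \<uu> = \<uu>" "reversal \<vv> = \<vv>"
  using reversal_mono[of 1 "[Gen_u]"] reversal_mono[of 1 "[Gen_v]"]
  by (simp_all add: \<uu>_def \<vv>_def of_coeff_1)

text \<open>Conjugation by an involutive anti-automorphism exchanges the factors twice, so it gives
  a derivation again, which is determined by its values on the generators.\<close>

lemma time_derivative_reversal:
  "time_derivative (reversal f) (reversal g) x = reversal (time_derivative f g (reversal x))"
proof -
  let ?D = "time_derivative f g" and ?R = "\<lambda>x. reversal (time_derivative f g (reversal x))"
  have D: "?D (x + y) = ?D x + ?D y" "?D (of_coeff c * x) = of_coeff c * ?D x"
    "?D (x * y) = ?D x * y + x * ?D y" for x y c
    using time_derivative_derivation(1)[of f g] unfolding kz_derivation_def by blast+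
  have scale: "reversal (of_coeff c * x) = of_coeff c * reversal x" for c x
    using reversal_mult[of "of_coeff c" x] by (simp add: reversal_of_coeff of_coeff_commute)
  have "kz_derivation ?R"
    unfolding kz_derivation_def scale D(2)
    by (simp add: D(1,3) reversal_add reversal_mult reversal_reversal add.commute)
  moreover have "?R \<uu> = reversal f" "?R \<vv> = reversal g"
    by (simp_all add: reversal_gens time_derivative_derivation)
  ultimately have "?R = alg_deriv (reversal f) (reversal g)"
    by (rule kz_derivation_unique)
  then show ?thesis
    unfolding time_derivative_eq by metis
qed

lemma first_integral_reversal:
  "first_integral f g j \<Longrightarrow> first_integral (reversal f) (reversal g) (reversal j)"
  by (simp add: first_integral_def time_derivative_reversal reversal_reversal reversal_0)

lemma reversal_minus: "reversal (- x) = - reversal x"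
  using reversal_add[of x "- x"] by (simp add: reversal_0 eq_neg_iff_add_eq_0 add.commute)

lemma reversal_zz: "reversal \<zz> = \<zz>"
  by (simp add: \<zz>_def reversal_of_coeff)

lemmas reversal_simps = reversal_minus reversal_zz reversal_add reversal_mult reversal_of_coeff reversal_gens reversal_0

lemma reversal_field_u:
  "reversal (alg_of (field_u \<kappa>\<^sub>1 \<kappa>\<^sub>2 \<kappa>\<^sub>4 a1 a2 a3 a4 c1 c2 c3 e1 e2)) =
   alg_of (field_u \<kappa>\<^sub>1 \<kappa>\<^sub>2 \<kappa>\<^sub>4 a4 a3 a2 a1 c3 c2 c1 e2 e1)"
  by (simp add: field_u_def reversal_simps expand_alg add_ac
      del: add_uminus_conv_diff uminus_add_conv_diff)

lemma reversal_field_v: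
  "reversal (alg_of (field_v \<kappa>\<^sub>1 \<kappa>\<^sub>2 \<kappa>\<^sub>3 \<kappa>\<^sub>4 b1 b2 b3 b4 b5 b6 d1 d2 d3 f1 f2)) =
   alg_of (field_v \<kappa>\<^sub>1 \<kappa>\<^sub>2 \<kappa>\<^sub>3 \<kappa>\<^sub>4 b6 b5 b3 b4 b2 b1 d3 d2 d1 f2 f1)"
  by (simp add: field_v_def reversal_simps expand_alg add_ac
      del: add_uminus_conv_diff uminus_add_conv_diff)

text \<open>Palindromes keep their parameter (\<open>p5\<close>, \<open>p7\<close>,
  \<open>q3\<close>, \<open>q4\<close>, \<open>r2\<close>, \<open>s2\<close>); the others are
  exchanged in pairs.\<close>

lemma reversal_integral_ansatz:
  "reversal (alg_of (integral_ansatz \<kappa>\<^sub>2 \<kappa>\<^sub>3 p1 p2 p3 p4 p5 p6 p7 p8 p9 p10 q1 q2 q3 q4 q5 q6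
     r1 r2 r3 s1 s2 s3 t1 t2 w1 w2)) =
   alg_of (integral_ansatz \<kappa>\<^sub>2 \<kappa>\<^sub>3 p10 p9 p6 p8 p5 p3 p7 p4 p2 p1 q6 q5 q3 q4 q2 q1
     r3 r2 r1 s3 s2 s1 t2 t1 w2 w1)"
  by (simp add: integral_ansatz_def reversal_simps expand_alg add_ac
      del: add_uminus_conv_diff uminus_add_conv_diff)

text \<open>Reduces \<open>w2 = 0\<close> to the case \<open>w1 = 0\<close>.\<close>

lemma (in integral_coefficients) reversed:
  "integral_coefficients \<kappa>\<^sub>1 \<kappa>\<^sub>2 \<kappa>\<^sub>3 \<kappa>\<^sub>4 a4 a3 a2 a1 b6 b5 b3 b4 b2 b1 c3 c2 c1 d3 d2 d1 e2 e1 f2 f1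
     p10 p9 p6 p8 p5 p3 p7 p4 p2 p1 q6 q5 q3 q4 q2 q1 r3 r2 r1 s3 s2 s1 t2 t1 w2 w1"
  using first_integral_reversal[OF integral] nonzero a_sum b_sum c_sum e_sum f_sum
    q_sum r_sum s_sum w_sum
  unfolding integral_coefficients_def reversal_field_u reversal_field_v reversal_integral_ansatz
  by (simp add: add_ac)

section \<open>The ten systems and their integrals\<close>

definition row_system where
  "row_system \<kappa>\<^sub>1 \<kappa>\<^sub>2 \<kappa>\<^sub>3 \<kappa>\<^sub>4 =
    (\<lambda>(a1, a2, a3, a4, b1, b2, b3, b4, b5, b6, c1, c2, c3, d1, d2, d3, e1, e2, f1, f2).
      (alg_of (field_u \<kappa>\<^sub>1 \<kappa>\<^sub>2 \<kappa>\<^sub>4 a1 a2 a3 a4 c1 c2 c3 e1 e2),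
       alg_of (field_v \<kappa>\<^sub>1 \<kappa>\<^sub>2 \<kappa>\<^sub>3 \<kappa>\<^sub>4 b1 b2 b3 b4 b5 b6 d1 d2 d3 f1 f2)))"

text \<open>Five systems and their reversals. The last table row is system (6), so its reversal (5)
  comes before it.\<close>

lemma listed_parts_eq:
  fixes \<theta> \<kappa>\<^sub>1 \<kappa>\<^sub>2 \<kappa>\<^sub>3 \<kappa>\<^sub>4 :: "'k::field"
  defines "x \<equiv> \<lambda>i. solution_table \<kappa>\<^sub>1 \<theta> ! i"
    and "R \<equiv> row_system \<kappa>\<^sub>1 \<kappa>\<^sub>2 \<kappa>\<^sub>3 \<kappa>\<^sub>4" and "R' \<equiv> map_prod reversal reversal \<circ> row_system \<kappa>\<^sub>1 \<kappa>\<^sub>2 \<kappa>\<^sub>3 \<kappa>\<^sub>4"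
  shows "map (\<lambda>(p, r). p5_system \<kappa>\<^sub>4 (p - \<kappa>\<^sub>1 \<cdot> \<uu>^2 + (\<kappa>\<^sub>1 + \<kappa>\<^sub>2) \<cdot> \<uu> - \<kappa>\<^sub>2 \<cdot> 1)
      (r - \<vv>^2 - (\<kappa>\<^sub>1 + \<kappa>\<^sub>2) \<cdot> \<vv> + \<kappa>\<^sub>3 \<cdot> 1)) (listed_parts \<kappa>\<^sub>1 \<theta>) =
    [R (x 0), R (x 1), R (x 2), R (x 3), R' (x 4), R (x 4), R' (x 0), R' (x 1), R' (x 2), R' (x 3)]"
  by (simp add: x_def solution_table_def R_def R'_def row_system_def reversal_simps
      listed_parts_def p5_system_def field_u_def field_v_def expand_alg add_ac
      del: add_uminus_conv_diff uminus_add_conv_diff)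

lemma listed_systems_eq:
  fixes \<kappa>\<^sub>1 :: "'k::field"
  shows "listed_systems \<kappa>\<^sub>1 \<kappa>\<^sub>2 \<kappa>\<^sub>3 \<kappa>\<^sub>4 =
    (\<Union>\<theta>\<in>{\<theta>. \<theta>^2 = \<kappa>\<^sub>1^2 + 4 * \<kappa>\<^sub>3}. \<Union>x\<in>set (solution_table \<kappa>\<^sub>1 \<theta>).
      {row_system \<kappa>\<^sub>1 \<kappa>\<^sub>2 \<kappa>\<^sub>3 \<kappa>\<^sub>4 x, map_prod reversal reversal (row_system \<kappa>\<^sub>1 \<kappa>\<^sub>2 \<kappa>\<^sub>3 \<kappa>\<^sub>4 x)})"
proof -
  let ?S = "\<lambda>(p, r). p5_system \<kappa>\<^sub>4 (p - \<kappa>\<^sub>1 \<cdot> \<uu>^2 + (\<kappa>\<^sub>1 + \<kappa>\<^sub>2) \<cdot> \<uu> - \<kappa>\<^sub>2 \<cdot> 1)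
      (r - \<vv>^2 - (\<kappa>\<^sub>1 + \<kappa>\<^sub>2) \<cdot> \<vv> + \<kappa>\<^sub>3 \<cdot> 1)"
  have *: "{f p r | p r \<theta>. P \<theta> \<and> (p, r) \<in> set (A \<theta>)} = (\<Union>\<theta>\<in>{\<theta>. P \<theta>}. set (map (\<lambda>(p, r). f p r) (A \<theta>)))"
    for f :: "'k free_alg \<Rightarrow> 'k free_alg \<Rightarrow> 'k free_alg \<times> 'k free_alg" and P :: "'k \<Rightarrow> bool" and A
    by force
  have **: "set [R (x 0), R (x 1), R (x 2), R (x 3), R' (x 4), R (x 4), R' (x 0), R' (x 1), R' (x 2), R' (x 3)] =
      (\<Union>y\<in>x ` {0, 1, 2, 3, 4}. {R y, R' y})" for x :: "nat \<Rightarrow> 'b" and R R' :: "'b \<Rightarrow> 'c"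
    by auto
  have "set (map ?S (listed_parts \<kappa>\<^sub>1 \<theta>)) = (\<Union>x\<in>set (solution_table \<kappa>\<^sub>1 \<theta>).
      {row_system \<kappa>\<^sub>1 \<kappa>\<^sub>2 \<kappa>\<^sub>3 \<kappa>\<^sub>4 x, (map_prod reversal reversal \<circ> row_system \<kappa>\<^sub>1 \<kappa>\<^sub>2 \<kappa>\<^sub>3 \<kappa>\<^sub>4) x})" for \<theta>
  proof -
    have table: "set (solution_table \<kappa>\<^sub>1 \<theta>) = (!) (solution_table \<kappa>\<^sub>1 \<theta>) ` {0, 1, 2, 3, 4}"
      by (simp add: solution_table_def)
    show ?thesis
      unfolding listed_parts_eq ** table ..
  qed
  then show ?thesis
    unfolding listed_systems_def * by (simp only: o_apply)
qed

section \<open>Explicit integrals for the five table rows\<close>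

primrec zero_trie :: "'c::zero trie \<Rightarrow> bool" where
  "zero_trie Leaf \<longleftrightarrow> True"
| "zero_trie (Node c l r) \<longleftrightarrow> c = 0 \<and> zero_trie l \<and> zero_trie r"

text \<open>Computed derivatives keep nodes with zero entries, so vanishing is tested at every node
  rather than by comparison with \<open>Leaf\<close>.\<close>

lemma first_integral_zero_trie:
  assumes "zero_trie (deriv_trie f g j)"
  shows "first_integral (alg_of f) (alg_of g) (alg_of j)"
proof -
  have "coeff_at t w = 0" if "zero_trie t" for t :: "'a poly trie" and w
    using that by (induction t w rule: coeff_at.induct) auto
  with assms show ?thesis
    by (simp add: first_integral_alg_of)
qed

text \<open>Using \<open>f\<close> for \<open>(\<kappa>\<^sub>1 + \<theta>) / 2\<close> and
  eliminating \<open>\<kappa>\<^sub>3\<close> leaves polynomial identities without square roots or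
  division. The \<open>p\<close>, \<open>q\<close>, \<open>r\<close>, \<open>s\<close> are the
  values forced in \<open>solution\<close>.\<close>

lemma first_integral_row_1_2:
  fixes f \<kappa>\<^sub>1 \<kappa>\<^sub>2 \<kappa>\<^sub>4 :: "'k::field"
  defines "\<kappa>\<^sub>3 \<equiv> f^2 - \<kappa>\<^sub>1 * f"
  shows "first_integral (alg_of (field_u \<kappa>\<^sub>1 \<kappa>\<^sub>2 \<kappa>\<^sub>4 0 0 2 0 0 (- 2) (- 2) 0 2))
      (alg_of (field_v \<kappa>\<^sub>1 \<kappa>\<^sub>2 \<kappa>\<^sub>3 \<kappa>\<^sub>4 0 0 0 (- 1) (- 2) 0 0 2 2 f (2 * \<kappa>\<^sub>1 - f)))
      (alg_of (integral_ansatz \<kappa>\<^sub>2 \<kappa>\<^sub>3 0 0 0 0 0 0 0 1 0 0 0 0 0 0 (- 2) 0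
        0 (- f) (f - \<kappa>\<^sub>1) 0 0 1 0 (\<kappa>\<^sub>1 + \<kappa>\<^sub>2) 0 \<kappa>\<^sub>4))"
    and "first_integral (alg_of (field_u \<kappa>\<^sub>1 \<kappa>\<^sub>2 \<kappa>\<^sub>4 0 0 2 0 0 (- 3) (- 1) 1 1))
      (alg_of (field_v \<kappa>\<^sub>1 \<kappa>\<^sub>2 \<kappa>\<^sub>3 \<kappa>\<^sub>4 0 0 0 (- 1) (- 2) 0 0 3 1 f (2 * \<kappa>\<^sub>1 - f)))
      (alg_of (integral_ansatz \<kappa>\<^sub>2 \<kappa>\<^sub>3 0 0 0 0 0 0 0 1 0 0 0 0 0 (- 1) (- 1) 0
        0 (- f) (f - \<kappa>\<^sub>1) 0 1 0 f (\<kappa>\<^sub>1 + \<kappa>\<^sub>2 - f) 0 \<kappa>\<^sub>4))"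
  unfolding \<kappa>\<^sub>3_def
  by (rule first_integral_zero_trie;
      simp add: field_u_def field_v_def integral_ansatz_def algebra_simps power2_eq_square)+

lemma first_integral_row_3_4_5:
  fixes \<kappa>\<^sub>1 \<kappa>\<^sub>2 \<kappa>\<^sub>3 \<kappa>\<^sub>4 :: "'k::field"
  shows "first_integral (alg_of (field_u \<kappa>\<^sub>1 \<kappa>\<^sub>2 \<kappa>\<^sub>4 0 0 1 1 0 (- 2) (- 2) 1 1))
      (alg_of (field_v \<kappa>\<^sub>1 \<kappa>\<^sub>2 \<kappa>\<^sub>3 \<kappa>\<^sub>4 0 0 0 0 (- 2) (- 1) 0 2 2 0 (2 * \<kappa>\<^sub>1)))
      (alg_of (integral_ansatz \<kappa>\<^sub>2 \<kappa>\<^sub>3 0 0 0 0 0 0 0 0 1 0 0 0 0 0 (- 2) 0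
        0 0 (- \<kappa>\<^sub>1) 0 1 0 0 (\<kappa>\<^sub>1 + \<kappa>\<^sub>2) 0 \<kappa>\<^sub>4))"
    and "first_integral (alg_of (field_u \<kappa>\<^sub>1 \<kappa>\<^sub>2 \<kappa>\<^sub>4 0 0 1 1 0 (- 1) (- 3) 0 2))
      (alg_of (field_v \<kappa>\<^sub>1 \<kappa>\<^sub>2 \<kappa>\<^sub>3 \<kappa>\<^sub>4 0 0 0 0 (- 2) (- 1) 0 1 3 0 (2 * \<kappa>\<^sub>1)))
      (alg_of (integral_ansatz \<kappa>\<^sub>2 \<kappa>\<^sub>3 0 0 0 0 0 0 0 0 1 0 0 0 0 0 (- 1) (- 1)
        0 0 (- \<kappa>\<^sub>1) 0 0 1 0 (\<kappa>\<^sub>1 + \<kappa>\<^sub>2) 0 \<kappa>\<^sub>4))"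
    and "first_integral (alg_of (field_u \<kappa>\<^sub>1 \<kappa>\<^sub>2 \<kappa>\<^sub>4 0 1 1 0 0 (- 3) (- 1) 0 2))
      (alg_of (field_v \<kappa>\<^sub>1 \<kappa>\<^sub>2 \<kappa>\<^sub>3 \<kappa>\<^sub>4 0 (- 1) 0 (- 1) (- 1) 0 0 3 1 \<kappa>\<^sub>1 \<kappa>\<^sub>1))
      (alg_of (integral_ansatz \<kappa>\<^sub>2 \<kappa>\<^sub>3 0 0 0 0 1 0 0 0 0 0 0 0 (- 1) 0 (- 1) 0
        0 (- \<kappa>\<^sub>1) 0 0 0 1 \<kappa>\<^sub>2 \<kappa>\<^sub>1 0 \<kappa>\<^sub>4))"
  by (rule first_integral_zero_trie;
      simp add: field_u_def field_v_def integral_ansatz_def algebra_simps)+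

text \<open>One parameter per word with linear relations, in place of eliminated coefficients:
  reversal then merely permutes the parameters.\<close>

definition integral_shape where
  "integral_shape \<kappa>\<^sub>1 \<kappa>\<^sub>2 \<kappa>\<^sub>3 \<kappa>\<^sub>4 J \<longleftrightarrow>
    (\<exists>p1 p2 p3 p4 p5 p6 p7 p8 p9 p10 q1 q2 q3 q4 q5 q6 r1 r2 r3 s1 s2 s3 t1 t2 w1 w2.
      p1 + p2 + p3 + p4 + p5 + p6 + p7 + p8 + p9 + p10 = 1 \<and>
      q1 + q2 + q3 + q4 + q5 + q6 = - 2 \<and> r1 + r2 + r3 = - \<kappa>\<^sub>1 \<and> s1 + s2 + s3 = 1 \<and>
      t1 + t2 = \<kappa>\<^sub>1 + \<kappa>\<^sub>2 \<and> w1 + w2 = \<kappa>\<^sub>4 \<and>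
      J = alg_of (integral_ansatz \<kappa>\<^sub>2 \<kappa>\<^sub>3 p1 p2 p3 p4 p5 p6 p7 p8 p9 p10 q1 q2 q3 q4 q5 q6
            r1 r2 r3 s1 s2 s3 t1 t2 w1 w2))"

lemma integral_shapeI:
  assumes "p1 + p2 + p3 + p4 + p5 + p6 + p7 + p8 + p9 + p10 = 1"
    and "q1 + q2 + q3 + q4 + q5 + q6 = - 2" and "r1 + r2 + r3 = - \<kappa>\<^sub>1" and "s1 + s2 + s3 = 1"
    and "t1 + t2 = \<kappa>\<^sub>1 + \<kappa>\<^sub>2" and "w1 + w2 = \<kappa>\<^sub>4"
  shows "integral_shape \<kappa>\<^sub>1 \<kappa>\<^sub>2 \<kappa>\<^sub>3 \<kappa>\<^sub>4
    (alg_of (integral_ansatz \<kappa>\<^sub>2 \<kappa>\<^sub>3 p1 p2 p3 p4 p5 p6 p7 p8 p9 p10 q1 q2 q3 q4 q5 q6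
      r1 r2 r3 s1 s2 s3 t1 t2 w1 w2))"
  unfolding integral_shape_def by (intro exI conjI) (rule assms refl)+

lemma J_poly_integral_shape:
  "(\<exists>p q r s t\<^sub>1 w\<^sub>1. J = J_poly \<kappa>\<^sub>1 \<kappa>\<^sub>2 \<kappa>\<^sub>3 \<kappa>\<^sub>4 p q r s t\<^sub>1 w\<^sub>1) \<longleftrightarrow>
    integral_shape \<kappa>\<^sub>1 \<kappa>\<^sub>2 \<kappa>\<^sub>3 \<kappa>\<^sub>4 J"
proof
  have "integral_shape \<kappa>\<^sub>1 \<kappa>\<^sub>2 \<kappa>\<^sub>3 \<kappa>\<^sub>4 (J_poly \<kappa>\<^sub>1 \<kappa>\<^sub>2 \<kappa>\<^sub>3 \<kappa>\<^sub>4 p q r s t\<^sub>1 w\<^sub>1)" for p q r s t\<^sub>1 w\<^sub>1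
    unfolding J_poly_eq sum_upto_5 sum_upto_9 by (rule integral_shapeI) (simp_all add: algebra_simps)
  then show "integral_shape \<kappa>\<^sub>1 \<kappa>\<^sub>2 \<kappa>\<^sub>3 \<kappa>\<^sub>4 J"
    if "\<exists>p q r s t\<^sub>1 w\<^sub>1. J = J_poly \<kappa>\<^sub>1 \<kappa>\<^sub>2 \<kappa>\<^sub>3 \<kappa>\<^sub>4 p q r s t\<^sub>1 w\<^sub>1"
    using that by blast
next
  assume "integral_shape \<kappa>\<^sub>1 \<kappa>\<^sub>2 \<kappa>\<^sub>3 \<kappa>\<^sub>4 J"
  then obtain p1 p2 p3 p4 p5 p6 p7 p8 p9 p10 q1 q2 q3 q4 q5 q6 r1 r2 r3 s1 s2 s3 t1 t2 w1 w2 where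
    sums: "p1 + p2 + p3 + p4 + p5 + p6 + p7 + p8 + p9 + p10 = 1"
      "q1 + q2 + q3 + q4 + q5 + q6 = - 2" "r1 + r2 + r3 = - \<kappa>\<^sub>1" "s1 + s2 + s3 = 1"
      "t1 + t2 = \<kappa>\<^sub>1 + \<kappa>\<^sub>2" "w1 + w2 = \<kappa>\<^sub>4"
    and J: "J = alg_of (integral_ansatz \<kappa>\<^sub>2 \<kappa>\<^sub>3 p1 p2 p3 p4 p5 p6 p7 p8 p9 p10 q1 q2 q3 q4 q5 q6
      r1 r2 r3 s1 s2 s3 t1 t2 w1 w2)"
    unfolding integral_shape_def by (elim exE conjE)
  have rest: "1 - (p1 + p2 + p3 + p4 + p5 + p6 + p7 + p8 + p9) = p10"
    "- 2 - (q1 + q2 + q3 + q4 + q5) = q6" "- \<kappa>\<^sub>1 - r1 - r2 = r3" "1 - s1 - s2 = s3"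
    "\<kappa>\<^sub>1 + \<kappa>\<^sub>2 - t1 = t2" "\<kappa>\<^sub>4 - w1 = w2"
    using sums by (simp_all add: diff_eq_eq add_ac)
  \<comment> \<open>The families are read from index \<open>1\<close>, hence the leading
    \<open>0\<close> in each list.\<close>
  have "J = J_poly \<kappa>\<^sub>1 \<kappa>\<^sub>2 \<kappa>\<^sub>3 \<kappa>\<^sub>4 ((!) [0, p1, p2, p3, p4, p5, p6, p7, p8, p9]) ((!) [0, q1, q2, q3, q4, q5])
      ((!) [0, r1, r2]) ((!) [0, s1, s2]) t1 w1"
    unfolding J J_poly_eq sum_upto_5 sum_upto_9 by (simp add: rest)
  then show "\<exists>p q r s t\<^sub>1 w\<^sub>1. J = J_poly \<kappa>\<^sub>1 \<kappa>\<^sub>2 \<kappa>\<^sub>3 \<kappa>\<^sub>4 p q r s t\<^sub>1 w\<^sub>1"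
    by blast
qed

lemma integral_shape_reversal:
  assumes "integral_shape \<kappa>\<^sub>1 \<kappa>\<^sub>2 \<kappa>\<^sub>3 \<kappa>\<^sub>4 J"
  shows "integral_shape \<kappa>\<^sub>1 \<kappa>\<^sub>2 \<kappa>\<^sub>3 \<kappa>\<^sub>4 (reversal J)"
  using assms unfolding integral_shape_def[of _ _ _ _ J]
proof (elim exE conjE)
  fix p1 p2 p3 p4 p5 p6 p7 p8 p9 p10 q1 q2 q3 q4 q5 q6 r1 r2 r3 s1 s2 s3 t1 t2 w1 w2
  assume sums: "p1 + p2 + p3 + p4 + p5 + p6 + p7 + p8 + p9 + p10 = 1"
      "q1 + q2 + q3 + q4 + q5 + q6 = - 2" "r1 + r2 + r3 = - \<kappa>\<^sub>1" "s1 + s2 + s3 = 1"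
      "t1 + t2 = \<kappa>\<^sub>1 + \<kappa>\<^sub>2" "w1 + w2 = \<kappa>\<^sub>4"
    and J: "J = alg_of (integral_ansatz \<kappa>\<^sub>2 \<kappa>\<^sub>3 p1 p2 p3 p4 p5 p6 p7 p8 p9 p10 q1 q2 q3 q4 q5 q6
      r1 r2 r3 s1 s2 s3 t1 t2 w1 w2)"
  show ?thesis
    unfolding J reversal_integral_ansatz using sums
    by (intro integral_shapeI) (simp_all add: add_ac)
qed

lemma row_has_integral:
  fixes \<kappa>\<^sub>1 \<kappa>\<^sub>2 \<kappa>\<^sub>3 \<kappa>\<^sub>4 \<theta> :: "'k::field"
  assumes "(2 :: 'k) \<noteq> 0" "\<theta>^2 = \<kappa>\<^sub>1^2 + 4 * \<kappa>\<^sub>3" "x \<in> set (solution_table \<kappa>\<^sub>1 \<theta>)"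
    "(f, g) = row_system \<kappa>\<^sub>1 \<kappa>\<^sub>2 \<kappa>\<^sub>3 \<kappa>\<^sub>4 x"
  shows "\<exists>J. integral_shape \<kappa>\<^sub>1 \<kappa>\<^sub>2 \<kappa>\<^sub>3 \<kappa>\<^sub>4 J \<and> first_integral f g J"
proof -
  \<comment> \<open>This is the coefficient \<open>f1\<close> of the first two rows, a root of
    \<open>h^2 = \<kappa>\<^sub>1 * h + \<kappa>\<^sub>3\<close>.\<close>
  define h where "h = (\<kappa>\<^sub>1 + \<theta>) / 2"
  have "2 * h = \<kappa>\<^sub>1 + \<theta>"
    using assms(1) by (simp add: h_def)
  then have \<theta>: "\<theta> = 2 * h - \<kappa>\<^sub>1"
    by simp
  have "2 * (2 * (\<kappa>\<^sub>3 - (h^2 - \<kappa>\<^sub>1 * h))) = 0"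
    using assms(2) unfolding \<theta> by algebra
  then have "\<kappa>\<^sub>3 - (h^2 - \<kappa>\<^sub>1 * h) = 0"
    using assms(1) by (simp only: mult_eq_0_iff simp_thms)
  then have \<kappa>\<^sub>3: "\<kappa>\<^sub>3 = h^2 - \<kappa>\<^sub>1 * h"
    by simp
  have f2: "(3 * \<kappa>\<^sub>1 - \<theta>) / 2 = 2 * \<kappa>\<^sub>1 - h"
    using assms(1) by (simp add: \<theta> field_simps)
  have ex: "\<exists>J. integral_shape \<kappa>\<^sub>1 \<kappa>\<^sub>2 \<kappa>\<^sub>3 \<kappa>\<^sub>4 J \<and> first_integral f g J"
    if "first_integral f g J" "integral_shape \<kappa>\<^sub>1 \<kappa>\<^sub>2 \<kappa>\<^sub>3 \<kappa>\<^sub>4 J" for f g J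
    using that by blast
  note rows = first_integral_row_1_2[where f = h and \<kappa>\<^sub>1 = \<kappa>\<^sub>1, folded \<kappa>\<^sub>3]
    first_integral_row_3_4_5
  have "\<exists>J. integral_shape \<kappa>\<^sub>1 \<kappa>\<^sub>2 \<kappa>\<^sub>3 \<kappa>\<^sub>4 J \<and> case_prod first_integral (row_system \<kappa>\<^sub>1 \<kappa>\<^sub>2 \<kappa>\<^sub>3 \<kappa>\<^sub>4 y) J"
    if "y \<in> set (solution_table \<kappa>\<^sub>1 \<theta>)" for y
    using that
    unfolding solution_table_def f2 h_def[symmetric] list.set insert_iff empty_iff simp_thms
    by (elim disjE; simp only: row_system_def prod.case)
      (rule rows[THEN ex], (rule integral_shapeI; simp add: algebra_simps; fail))+
  then show ?thesis
    using assms(3,4) by (metis prod.case)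
qed

text \<open>A field embedding preserves numerals and sends invertible elements to invertible ones,
  so characteristic zero carries over from the complex numbers.\<close>

lemma field_embedding_numeral_nonzero:
  fixes \<iota> :: "complex \<Rightarrow> 'k::field"
  assumes "field_embedding \<iota>"
  shows "(numeral n :: 'k) \<noteq> 0"
proof
  have hom: "\<iota> 1 = 1" "\<iota> (x + y) = \<iota> x + \<iota> y" "\<iota> (x * y) = \<iota> x * \<iota> y" for x y
    using assms by (simp_all add: field_embedding_def)
  have "\<iota> (numeral n) = numeral n" for n
    by (induction n) (simp_all only: hom numeral.simps)
  moreover assume "(numeral n :: 'k) = 0"
  moreover have "\<iota> (numeral n) * \<iota> (inverse (numeral n)) = 1"
    by (metis hom(1,3) right_inverse zero_neq_numeral)
  ultimately show False
    by simp
qed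

text \<open>If \<open>x\<^sub>4\<close> were zero, the fourth indeterminate itself would be a
  nontrivial relation.\<close>

lemma alg_independent4_nonzero:
  fixes \<iota> :: "complex \<Rightarrow> 'k::field"
  assumes "field_embedding \<iota>" "alg_independent4 \<iota> x\<^sub>1 x\<^sub>2 x\<^sub>3 x\<^sub>4"
  shows "x\<^sub>4 \<noteq> 0"
proof
  let ?f = "Poly_Mapping.single (0, 0, 0, 1) 1 :: nat \<times> nat \<times> nat \<times> nat \<Rightarrow>\<^sub>0 complex"
  assume "x\<^sub>4 = 0"
  then have "?f = 0"
    using assms(2)[unfolded alg_independent4_def, rule_format, of ?f] by simp
  then have "Poly_Mapping.lookup ?f (0, 0, 0, 1) = 0"
    by simp
  then show False
    by simp
qed

theorem proposition2:
  fixes \<iota> :: "complex \<Rightarrow> 'k::alg_closed_field"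
    and \<kappa>\<^sub>1 \<kappa>\<^sub>2 \<kappa>\<^sub>3 \<kappa>\<^sub>4 :: 'k
    and a b c d :: "nat \<Rightarrow> 'k" and e\<^sub>1 f\<^sub>1 :: 'k
    and F\<^sub>1 F\<^sub>2 :: "'k free_alg"
  assumes "arbitrary_parameters \<iota> \<kappa>\<^sub>1 \<kappa>\<^sub>2 \<kappa>\<^sub>3 \<kappa>\<^sub>4"
    and "(F\<^sub>1, F\<^sub>2) = p5_system \<kappa>\<^sub>4 (P1_poly \<kappa>\<^sub>1 \<kappa>\<^sub>2 a c e\<^sub>1) (P2_poly \<kappa>\<^sub>1 \<kappa>\<^sub>2 \<kappa>\<^sub>3 b d f\<^sub>1)"
  shows "(\<exists>p q r s t\<^sub>1 w\<^sub>1. first_integral F\<^sub>1 F\<^sub>2 (J_poly \<kappa>\<^sub>1 \<kappa>\<^sub>2 \<kappa>\<^sub>3 \<kappa>\<^sub>4 p q r s t\<^sub>1 w\<^sub>1))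
    \<longleftrightarrow> (F\<^sub>1, F\<^sub>2) \<in> listed_systems \<kappa>\<^sub>1 \<kappa>\<^sub>2 \<kappa>\<^sub>3 \<kappa>\<^sub>4"
proof -
  have nonzero: "(2 :: 'k) \<noteq> 0" "(3 :: 'k) \<noteq> 0" "\<kappa>\<^sub>4 \<noteq> 0"
    using assms(1) field_embedding_numeral_nonzero[of \<iota>] alg_independent4_nonzero[of \<iota>]
    unfolding arbitrary_parameters_def by blast+
  have root: "\<exists>\<theta>. \<theta>^2 = \<kappa>\<^sub>1^2 + 4 * \<kappa>\<^sub>3"
    by (rule nth_root_exists) simp
  have "(\<exists>p q r s t\<^sub>1 w\<^sub>1. first_integral F\<^sub>1 F\<^sub>2 (J_poly \<kappa>\<^sub>1 \<kappa>\<^sub>2 \<kappa>\<^sub>3 \<kappa>\<^sub>4 p q r s t\<^sub>1 w\<^sub>1)) \<longleftrightarrow>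
    (\<exists>J. integral_shape \<kappa>\<^sub>1 \<kappa>\<^sub>2 \<kappa>\<^sub>3 \<kappa>\<^sub>4 J \<and> first_integral F\<^sub>1 F\<^sub>2 J)"
    by (metis J_poly_integral_shape)
  also have "\<dots> \<longleftrightarrow> (F\<^sub>1, F\<^sub>2) \<in> listed_systems \<kappa>\<^sub>1 \<kappa>\<^sub>2 \<kappa>\<^sub>3 \<kappa>\<^sub>4"
  proof
    assume "\<exists>J. integral_shape \<kappa>\<^sub>1 \<kappa>\<^sub>2 \<kappa>\<^sub>3 \<kappa>\<^sub>4 J \<and> first_integral F\<^sub>1 F\<^sub>2 J"
    then obtain J where J: "integral_shape \<kappa>\<^sub>1 \<kappa>\<^sub>2 \<kappa>\<^sub>3 \<kappa>\<^sub>4 J" "first_integral F\<^sub>1 F\<^sub>2 J"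
      by blast
    obtain p1 p2 p3 p4 p5 p6 p7 p8 p9 p10 q1 q2 q3 q4 q5 q6 r1 r2 r3 s1 s2 s3 t1 t2 w1 w2 where
      sums: "q1 + q2 + q3 + q4 + q5 + q6 = - 2" "r1 + r2 + r3 = - \<kappa>\<^sub>1" "s1 + s2 + s3 = 1"
        "w1 + w2 = \<kappa>\<^sub>4"
      and J_eq: "J = alg_of (integral_ansatz \<kappa>\<^sub>2 \<kappa>\<^sub>3 p1 p2 p3 p4 p5 p6 p7 p8 p9 p10
        q1 q2 q3 q4 q5 q6 r1 r2 r3 s1 s2 s3 t1 t2 w1 w2)"
      using J(1) unfolding integral_shape_def by (elim exE conjE)
    let ?a4 = "2 - a 1 - a 2 - a 3" and ?b6 = "- 3 - (b 1 + b 2 + b 3 + b 4 + b 5)" and ?c2 = "- 4 - c 1 - c 2"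
      and ?d2 = "4 - d 1 - d 2" and ?e2 = "2 - e\<^sub>1" and ?f2 = "2 * \<kappa>\<^sub>1 - f\<^sub>1"
    let ?row = "(a 1, a 2, a 3, ?a4, b 1, b 2, b 3, b 4, b 5, ?b6, c 1, ?c2, c 2, d 1, ?d2, d 2,
      e\<^sub>1, ?e2, f\<^sub>1, ?f2)"
    have F: "(F\<^sub>1, F\<^sub>2) = row_system \<kappa>\<^sub>1 \<kappa>\<^sub>2 \<kappa>\<^sub>3 \<kappa>\<^sub>4 ?row"
      using assms(2) by (simp only: p5_system_eq sum_upto_5 row_system_def prod.case)
    interpret integral_coefficients \<kappa>\<^sub>1 \<kappa>\<^sub>2 \<kappa>\<^sub>3 \<kappa>\<^sub>4 "a 1" "a 2" "a 3" ?a4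
      "b 1" "b 2" "b 3" "b 4" "b 5" ?b6 "c 1" ?c2 "c 2" "d 1" ?d2 "d 2" e\<^sub>1 ?e2 f\<^sub>1 ?f2
      p1 p2 p3 p4 p5 p6 p7 p8 p9 p10 q1 q2 q3 q4 q5 q6 r1 r2 r3 s1 s2 s3 t1 t2 w1 w2
      using nonzero sums J(2) J_eq F by unfold_locales (simp_all add: row_system_def)
    show "(F\<^sub>1, F\<^sub>2) \<in> listed_systems \<kappa>\<^sub>1 \<kappa>\<^sub>2 \<kappa>\<^sub>3 \<kappa>\<^sub>4"
      using w1_or_w2_zero
    proof
      assume "w1 = 0"
      from solution[OF this root] show ?thesis
        unfolding listed_systems_eq F by blast
    next
      assume "w2 = 0"
      \<comment> \<open>The row of the reversed system, to which the case \<open>w1 = 0\<close>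
        applies; reversing once more recovers the given system.\<close>
      let ?rev = "(?a4, a 3, a 2, a 1, ?b6, b 5, b 3, b 4, b 2, b 1, c 2, ?c2, c 1, d 2, ?d2, d 1,
        ?e2, e\<^sub>1, ?f2, f\<^sub>1)"
      have "(F\<^sub>1, F\<^sub>2) = map_prod reversal reversal (row_system \<kappa>\<^sub>1 \<kappa>\<^sub>2 \<kappa>\<^sub>3 \<kappa>\<^sub>4 ?rev)"
        unfolding F row_system_def by (simp only: prod.case map_prod_simp reversal_field_u reversal_field_v)
      then show ?thesis
        using integral_coefficients.solution[OF reversed \<open>w2 = 0\<close> root]
        unfolding listed_systems_eq by blast
    qed
  next
    assume "(F\<^sub>1, F\<^sub>2) \<in> listed_systems \<kappa>\<^sub>1 \<kappa>\<^sub>2 \<kappa>\<^sub>3 \<kappa>\<^sub>4"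
    then obtain \<theta> x where \<theta>: "\<theta>^2 = \<kappa>\<^sub>1^2 + 4 * \<kappa>\<^sub>3" and x: "x \<in> set (solution_table \<kappa>\<^sub>1 \<theta>)"
      and F: "(F\<^sub>1, F\<^sub>2) = row_system \<kappa>\<^sub>1 \<kappa>\<^sub>2 \<kappa>\<^sub>3 \<kappa>\<^sub>4 x \<or>
        (F\<^sub>1, F\<^sub>2) = map_prod reversal reversal (row_system \<kappa>\<^sub>1 \<kappa>\<^sub>2 \<kappa>\<^sub>3 \<kappa>\<^sub>4 x)"
      unfolding listed_systems_eq by blast
    obtain f g where fg: "(f, g) = row_system \<kappa>\<^sub>1 \<kappa>\<^sub>2 \<kappa>\<^sub>3 \<kappa>\<^sub>4 x"
      by (metis surj_pair)
    obtain J where "integral_shape \<kappa>\<^sub>1 \<kappa>\<^sub>2 \<kappa>\<^sub>3 \<kappa>\<^sub>4 J" "first_integral f g J"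
      using row_has_integral[OF nonzero(1) \<theta> x fg] by blast
    with F show "\<exists>J. integral_shape \<kappa>\<^sub>1 \<kappa>\<^sub>2 \<kappa>\<^sub>3 \<kappa>\<^sub>4 J \<and> first_integral F\<^sub>1 F\<^sub>2 J"
      unfolding fg[symmetric] map_prod_simp
      using integral_shape_reversal first_integral_reversal by blast
  qed
  finally show ?thesis .
qed

end
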